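(* Let $\Omega=(0,1)^2$ and let $0<\varepsilon\ll 1$ be a small perturbation parameter. Let $\mathbf b=(b_1(x,y),b_2(x,y))$ and $f=f(x,y)$ be given functions with $b_1>0$ and $b_2>0$ in $\Omega$ (non-characteristic boundary case). Assume that the data $f$ and $\mathbf b$ are sufficiently regular; in particular, they are assumed smooth enough that the solution $u^0$ of the limit problem $$-b_1\frac{\partial u^0}{\partial x}-b_2\frac{\partial u^0}{\partial y}=f\ \text{ in }\Omega,\qquad u^0=0\ \text{ at } x=1 \text{ or } y=1,$$ is sufficiently regular. Let $u=u^\varepsilon$ be the solution of $$-\varepsilon\Delta u-\mathbf b\cdot\nabla u=f\ \text{ in }\Omega,\qquad u=0\ \text{ on }\partial\Omega,$$ and let $\theta_B,\theta_L,\eta$ be the ($\varepsilon$-dependent) correctors defined in the context. Then $u$ satisfies the asymptotic expansion $u\simeq u^0+\theta_B+\theta_L+\eta$ in the sense that $$\|u-u^0-\theta_B-\theta_L-\eta\|_\varepsilon\le\kappa\,\varepsilon^{3/4},$$ with a constant $\kappa$ independent of $\varepsilon$. Moreover, $u$ converges to $u^0$ as $\varepsilon$ tends to zero, with $$\|u-u^0\|_{L^2(\Omega)}\le\kappa\,\varepsilon^{1/4}.$$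
   Context: The norms are $\|v\|_{L^2(\Omega)}=\left(\int_\Omega|v|^2\,dx\,dy\right)^{1/2}$ and $\|v\|_\varepsilon=\|v\|_{L^2(\Omega)}+\sqrt{\varepsilon}\,\|\nabla v\|_{L^2(\Omega)}$. Cut-off functions: $\sigma_B=\sigma_B(y)$ and $\sigma_L=\sigma_L(x)$ are smooth functions with $\sigma_B(y)=1$ for $0\le y\le 1/8$, $\sigma_B(y)=0$ for $y\ge 1/4$, and $\sigma_L(x)=1$ for $0\le x\le 1/8$, $\sigma_L(x)=0$ for $x\ge 1/4$. Correctors: $\theta_B(x,y)=-\sigma_B(y)\,u^0(x,0)\exp\left(-b_2(x,0)\,y/\varepsilon\right)$ (ordinary boundary layer corrector near $y=0$); $\theta_L(x,y)=-\sigma_L(x)\,u^0(0,y)\exp\left(-b_1(0,y)\,x/\varepsilon\right)$ (ordinary boundary layer corrector near $x=0$); $\eta(x,y)=\sigma_L(x)\,\sigma_B(y)\,u^0(0,0)\exp\left(-b_1(0,0)\,x/\varepsilon\right)\exp\left(-b_2(0,0)\,y/\varepsilon\right)$ (corner corrector near $(0,0)$). *)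

theory Defs
  imports "HOL-Analysis.Analysis"
begin

definition Omega :: "(real \<times> real) set" where
  "Omega = {0<..<1} \<times> {0<..<1}"

text \<open>
  \<open>Ck_on k S v\<close>: the function v is k times continuously differentiable on S.  The derivative is taken
  relative to S, so on the closed square this is the usual class of functions whose partial
  derivatives up to order k extend continuously to the boundary; on an open S it is the
  ordinary class of k times continuously differentiable functions.  In both cases the partial
  derivatives \<open>vx\<close>, \<open>vy\<close> are uniquely determined on S.
\<close>

primrec Ck_on :: "nat \<Rightarrow> (real \<times> real) set \<Rightarrow> (real \<times> real \<Rightarrow> real) \<Rightarrow> bool" where
  "Ck_on 0 S v \<longleftrightarrow> continuous_on S v"
| "Ck_on (Suc k) S v \<longleftrightarrow>
     (\<exists>vx vy. (\<forall>p\<in>S. (v has_derivative (\<lambda>h. vx p * fst h + vy p * snd h)) (at p within S))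
            \<and> Ck_on k S vx \<and> Ck_on k S vy)"

definition dx :: "(real \<times> real \<Rightarrow> real) \<Rightarrow> real \<times> real \<Rightarrow> real" where
  "dx v = (\<lambda>(x, y). deriv (\<lambda>s. v (s, y)) x)"

definition dy :: "(real \<times> real \<Rightarrow> real) \<Rightarrow> real \<times> real \<Rightarrow> real" where
  "dy v = (\<lambda>(x, y). deriv (\<lambda>t. v (x, t)) y)"

definition grad :: "(real \<times> real \<Rightarrow> real) \<Rightarrow> real \<times> real \<Rightarrow> real \<times> real" where
  "grad v p = (dx v p, dy v p)"

definition laplacian :: "(real \<times> real \<Rightarrow> real) \<Rightarrow> real \<times> real \<Rightarrow> real" where
  "laplacian v p = dx (dx v) p + dy (dy v) p"

text \<open>
  Lebesgue space membership and norm, for scalar functions and for vector fields.  Outside the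
  space \<open>in_L2\<close> the Bochner integral in \<open>L2_norm\<close> may be the junk value 0, so an estimate of
  \<open>L2_norm v\<close> is only meaningful together with \<open>in_L2 v\<close>.
\<close>

definition in_L2 :: "(real \<times> real \<Rightarrow> 'a::euclidean_space) \<Rightarrow> bool" where
  "in_L2 v \<longleftrightarrow> set_borel_measurable lborel Omega v
           \<and> set_integrable lborel Omega (\<lambda>p. (norm (v p))\<^sup>2)"

definition L2_norm :: "(real \<times> real \<Rightarrow> 'a::euclidean_space) \<Rightarrow> real" where
  "L2_norm v = sqrt (LINT p:Omega|lborel. (norm (v p))\<^sup>2)"

definition eps_norm :: "real \<Rightarrow> (real \<times> real \<Rightarrow> real) \<Rightarrow> real" where
  "eps_norm \<epsilon> v = L2_norm v + sqrt \<epsilon> * L2_norm (grad v)"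

text \<open>
  Classical solutions of the limit problem and of the perturbed problem.  The solution of the
  perturbed problem is only required to be regular in the open square, since the corners and the
  lack of compatibility conditions in general limit its regularity up to the boundary.
\<close>

definition limit_solution ::
  "(real \<times> real \<Rightarrow> real) \<Rightarrow> (real \<times> real \<Rightarrow> real) \<Rightarrow> (real \<times> real \<Rightarrow> real) \<Rightarrow> (real \<times> real \<Rightarrow> real) \<Rightarrow> bool"
where
  "limit_solution b1 b2 f u0 \<longleftrightarrow>
     (\<forall>p\<in>Omega. - b1 p * dx u0 p - b2 p * dy u0 p = f p)
   \<and> (\<forall>p\<in>closure Omega. fst p = 1 \<or> snd p = 1 \<longrightarrow> u0 p = 0)"

definition perturbed_solution ::
  "(real \<times> real \<Rightarrow> real) \<Rightarrow> (real \<times> real \<Rightarrow> real) \<Rightarrow> (real \<times> real \<Rightarrow> real) \<Rightarrow> real \<Rightarrow> (real \<times> real \<Rightarrow> real) \<Rightarrow> bool"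
where
  "perturbed_solution b1 b2 f \<epsilon> u \<longleftrightarrow>
     Ck_on 2 Omega u \<and> continuous_on (closure Omega) u
   \<and> (\<forall>p\<in>Omega. - \<epsilon> * laplacian u p - (b1 p, b2 p) \<bullet> grad u p = f p)
   \<and> (\<forall>p\<in>frontier Omega. u p = 0)"

text \<open>
  The boundary is non-characteristic: the normal component of the field (b1, b2) vanishes nowhere
  on the four closed edges.
\<close>

definition noncharacteristic :: "(real \<times> real \<Rightarrow> real) \<Rightarrow> (real \<times> real \<Rightarrow> real) \<Rightarrow> bool" where
  "noncharacteristic b1 b2 \<longleftrightarrow>
     (\<forall>y\<in>{0..1}. b1 (0, y) \<noteq> 0 \<and> b1 (1, y) \<noteq> 0)
   \<and> (\<forall>x\<in>{0..1}. b2 (x, 0) \<noteq> 0 \<and> b2 (x, 1) \<noteq> 0)"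

definition cutoff :: "(real \<Rightarrow> real) \<Rightarrow> bool" where
  "cutoff \<sigma> \<longleftrightarrow> (\<forall>n t. (deriv ^^ n) \<sigma> differentiable (at t))
            \<and> (\<forall>t. 0 \<le> t \<and> t \<le> 1/8 \<longrightarrow> \<sigma> t = 1)
            \<and> (\<forall>t. t \<ge> 1/4 \<longrightarrow> \<sigma> t = 0)"

definition theta_B ::
  "(real \<Rightarrow> real) \<Rightarrow> (real \<times> real \<Rightarrow> real) \<Rightarrow> (real \<times> real \<Rightarrow> real) \<Rightarrow> real \<Rightarrow> real \<times> real \<Rightarrow> real"
where
  "theta_B \<sigma>B b2 u0 \<epsilon> = (\<lambda>(x, y). - \<sigma>B y * u0 (x, 0) * exp (- b2 (x, 0) * y / \<epsilon>))"

definition theta_L ::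
  "(real \<Rightarrow> real) \<Rightarrow> (real \<times> real \<Rightarrow> real) \<Rightarrow> (real \<times> real \<Rightarrow> real) \<Rightarrow> real \<Rightarrow> real \<times> real \<Rightarrow> real"
where
  "theta_L \<sigma>L b1 u0 \<epsilon> = (\<lambda>(x, y). - \<sigma>L x * u0 (0, y) * exp (- b1 (0, y) * x / \<epsilon>))"

definition eta ::
  "(real \<Rightarrow> real) \<Rightarrow> (real \<Rightarrow> real) \<Rightarrow> (real \<times> real \<Rightarrow> real) \<Rightarrow> (real \<times> real \<Rightarrow> real)
     \<Rightarrow> (real \<times> real \<Rightarrow> real) \<Rightarrow> real \<Rightarrow> real \<times> real \<Rightarrow> real"
where
  "eta \<sigma>L \<sigma>B b1 b2 u0 \<epsilon> = (\<lambda>(x, y).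
     \<sigma>L x * \<sigma>B y * u0 (0, 0) * exp (- b1 (0, 0) * x / \<epsilon>) * exp (- b2 (0, 0) * y / \<epsilon>))"

end

theory Submission
  imports Defs
begin

text \<open>
  The remainder \<open>w = u - u0 - \<theta>\<^sub>B - \<theta>\<^sub>L - \<eta>\<close> vanishes on the boundary of the square, and freezing the
  coefficients at the edges \<open>y = 0\<close> and \<open>x = 0\<close> shows that
  \<open>\<bar>- \<epsilon> \<Delta>w - b \<bullet> \<nabla>w\<bar> \<le> C (\<epsilon> + exp (- \<gamma> x / \<epsilon>) + exp (- \<gamma> y / \<epsilon>))\<close>.  Since \<open>b1 + b2\<close> is bounded below on
  the closed square (\<open>b1\<close> alone may vanish on \<open>y = 0\<close>), and \<open>b1\<close>, \<open>b2\<close> are bounded below near their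
  outflow edges, a multiple of \<open>\<epsilon> (A (2 - x - y) + B exp (- \<gamma> x / \<epsilon>) + B exp (- \<gamma> y / \<epsilon>))\<close> is a barrier
  for this right-hand side, so the maximum principle gives \<open>\<bar>w\<bar> \<le> M \<epsilon>\<close> pointwise.  Testing the equation
  with \<open>w\<close> then yields \<open>\<epsilon> \<integral>\<bar>\<nabla>w\<bar>\<^sup>2 \<le> \<kappa> \<epsilon>\<^sup>2\<close>, because the right-hand side has integral of order \<open>\<epsilon>\<close>.  The
  resulting bound \<open>\<kappa> \<epsilon>\<close> in the energy norm is stronger than the claimed \<open>\<kappa> \<epsilon> powr (3/4)\<close>; the bound for
  \<open>u - u0\<close> follows since the correctors have norm of order \<open>sqrt \<epsilon>\<close>.

  As \<open>u\<close> is only continuous up to the boundary, the energy identity is derived for a truncation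
  \<open>\<Psi>(v)\<close> that vanishes where \<open>v\<close> is small, hence near the boundary.
\<close>

section \<open>Partial derivatives and comparison\<close>

text \<open>No sign of div b is assumed, so testing the equation with w leaves a term 1/2
  \<integral> (div b) w^2 that may be negative. Once |w| \<le> M \<epsilon> is known, this term is
  of order \<epsilon>^2 like the right-hand side, which is why the pointwise bound precedes the
  gradient bound. The residual of the correctors is of order one inside the layers, so \<epsilon>
  times a fixed smooth function cannot be a barrier. The operator maps \<epsilon> exp (- \<gamma> x
  / \<epsilon>) to \<gamma> (b1 - \<gamma>) exp (- \<gamma> x / \<epsilon>), which has the right
  size and sign near x = 0, where b1 \<ge> 2 \<gamma>. Farther away the exponential is itself of
  order \<epsilon>, and the linear part of the barrier pays for the lost sign. The rate \<gamma> is
  a third of a lower bound for the normal speeds on x = 0 and y = 0: a third is given up when the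
  coefficients leave the edge, and the barrier uses the remaining 2 \<gamma>.\<close>

text \<open>Only slice derivatives and pure second partials are recorded: the operator has no mixed
  term, and both the test at an interior minimum and the fundamental theorem of calculus work along
  lines.\<close>

definition C2_partials ::
  "(real \<times> real \<Rightarrow> real) \<Rightarrow> (real \<times> real \<Rightarrow> real) \<Rightarrow> (real \<times> real \<Rightarrow> real)
     \<Rightarrow> (real \<times> real \<Rightarrow> real) \<Rightarrow> (real \<times> real \<Rightarrow> real) \<Rightarrow> bool" where
  "C2_partials v vx vy vxx vyy \<longleftrightarrow>
     continuous_on Omega v \<and> continuous_on Omega vx \<and> continuous_on Omega vy
   \<and> continuous_on Omega vxx \<and> continuous_on Omega vyy
   \<and> (\<forall>x y. (x, y) \<in> Omega \<longrightarrow>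
        ((\<lambda>s. v (s, y)) has_real_derivative vx (x, y)) (at x)
      \<and> ((\<lambda>t. v (x, t)) has_real_derivative vy (x, y)) (at y)
      \<and> ((\<lambda>s. vx (s, y)) has_real_derivative vxx (x, y)) (at x)
      \<and> ((\<lambda>t. vy (x, t)) has_real_derivative vyy (x, y)) (at y))"

lemma mem_Omega [simp]: "(x, y) \<in> Omega \<longleftrightarrow> 0 < x \<and> x < 1 \<and> 0 < y \<and> y < 1"
  by (auto simp: Omega_def)

lemma open_Omega [simp, intro]: "open Omega"
  by (simp add: Omega_def open_Times)

lemma closure_Omega: "closure Omega = {0..1} \<times> {0..1}"
  by (simp add: Omega_def closure_Times)

lemma mem_closure_Omega [simp]: "(x, y) \<in> closure Omega \<longleftrightarrow> 0 \<le> x \<and> x \<le> 1 \<and> 0 \<le> y \<and> y \<le> 1"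
  by (auto simp: closure_Omega)

lemma compact_closure_Omega: "compact (closure Omega)"
  by (simp add: closure_Omega compact_Times)

lemma frontier_Omega: "frontier Omega = closure Omega - Omega"
  by (simp add: frontier_def interior_open)

lemma C2_partials_add:
  assumes "C2_partials v vx vy vxx vyy" "C2_partials w wx wy wxx wyy"
  shows "C2_partials (\<lambda>p. v p + w p) (\<lambda>p. vx p + wx p) (\<lambda>p. vy p + wy p)
    (\<lambda>p. vxx p + wxx p) (\<lambda>p. vyy p + wyy p)"
  using assms unfolding C2_partials_def by (auto intro: continuous_on_add continuous_on_diff DERIV_add DERIV_diff)

lemma C2_partials_cmult:
  assumes "C2_partials v vx vy vxx vyy"
  shows "C2_partials (\<lambda>p. c * v p) (\<lambda>p. c * vx p) (\<lambda>p. c * vy p) (\<lambda>p. c * vxx p) (\<lambda>p. c * vyy p)"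
  using assms unfolding C2_partials_def by (auto intro: continuous_on_mult_left DERIV_cmult)

lemma C2_partials_diff:
  assumes "C2_partials v vx vy vxx vyy" "C2_partials w wx wy wxx wyy"
  shows "C2_partials (\<lambda>p. v p - w p) (\<lambda>p. vx p - wx p) (\<lambda>p. vy p - wy p)
    (\<lambda>p. vxx p - wxx p) (\<lambda>p. vyy p - wyy p)"
  using assms unfolding C2_partials_def by (auto intro: continuous_on_add continuous_on_diff DERIV_add DERIV_diff)

text \<open>Exchanging the coordinates turns the layer at y = 0 into the layer at x = 0, so that the
  residual estimate is proved for one of them only.\<close>

lemma C2_partials_swap:
  assumes "C2_partials v vx vy vxx vyy"
  shows "C2_partials (\<lambda>p. v (prod.swap p)) (\<lambda>p. vy (prod.swap p)) (\<lambda>p. vx (prod.swap p))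
    (\<lambda>p. vyy (prod.swap p)) (\<lambda>p. vxx (prod.swap p))"
proof -
  have "continuous_on Omega (\<lambda>p. h (prod.swap p))" if "continuous_on Omega h" for h :: "real \<times> real \<Rightarrow> real"
    by (rule continuous_on_compose2[OF that continuous_on_swap]) (auto simp: Omega_def)
  with assms show ?thesis unfolding C2_partials_def by auto
qed

lemma C2_partials_deriv:
  assumes "C2_partials v vx vy vxx vyy" "p \<in> Omega"
  shows "dx v p = vx p" "dy v p = vy p" "dx (dx v) p = vxx p" "dy (dy v) p = vyy p"
proof -
  obtain x y where p: "p = (x, y)" by fastforce
  have 1: "dx v (s, t) = vx (s, t)" "dy v (s, t) = vy (s, t)" if "(s, t) \<in> Omega" for s t
    using assms(1) that unfolding C2_partials_def dx_def dy_def by (auto intro!: DERIV_imp_deriv)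
  show "dx v p = vx p" "dy v p = vy p" using 1 assms(2) p by auto
  have "((\<lambda>s. dx v (s, y)) has_real_derivative vxx p) (at x)"
    by (rule has_field_derivative_transform_within_open[where f = "\<lambda>s. vx (s, y)" and S = "{0<..<1}"])
      (use assms 1 in \<open>auto simp: C2_partials_def p\<close>)
  thus "dx (dx v) p = vxx p" by (auto simp: dx_def[of "dx v"] p intro: DERIV_imp_deriv)
  have "((\<lambda>t. dy v (x, t)) has_real_derivative vyy p) (at y)"
    by (rule has_field_derivative_transform_within_open[where f = "\<lambda>t. vy (x, t)" and S = "{0<..<1}"])
      (use assms 1 in \<open>auto simp: C2_partials_def p\<close>)
  thus "dy (dy v) p = vyy p" by (auto simp: dy_def[of "dy v"] p intro: DERIV_imp_deriv)
qed

text \<open>The derivative stays relative to the slice of S, since for the data S is the closed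
  square and the slices of interest lie in its edges.\<close>

lemma has_real_derivative_slice:
  assumes "(v has_derivative (\<lambda>h. a * fst h + b * snd h)) (at (x, y) within S)"
  shows "((\<lambda>s. v (s, y)) has_real_derivative a) (at x within {s. (s, y) \<in> S})"
    and "((\<lambda>t. v (x, t)) has_real_derivative b) (at y within {t. (x, t) \<in> S})"
proof -
  have "(v has_derivative (\<lambda>h. a * fst h + b * snd h)) (at (x, y) within (\<lambda>s. (s, y)) ` {s. (s, y) \<in> S})"
    by (rule has_derivative_subset[OF assms]) auto
  from has_derivative_in_compose[OF _ this, of "\<lambda>h. (h, 0)"]
  have "((\<lambda>s. v (s, y)) has_derivative (\<lambda>h. a * h)) (at x within {s. (s, y) \<in> S})"
    by (simp add: has_derivative_Pair)
  thus "((\<lambda>s. v (s, y)) has_real_derivative a) (at x within {s. (s, y) \<in> S})"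
    by (simp add: has_field_derivative_def)
  have "(v has_derivative (\<lambda>h. a * fst h + b * snd h)) (at (x, y) within (\<lambda>t. (x, t)) ` {t. (x, t) \<in> S})"
    by (rule has_derivative_subset[OF assms]) auto
  from has_derivative_in_compose[OF _ this, of "\<lambda>h. (0, h)"]
  have "((\<lambda>t. v (x, t)) has_derivative (\<lambda>h. b * h)) (at y within {t. (x, t) \<in> S})"
    by (simp add: has_derivative_Pair)
  thus "((\<lambda>t. v (x, t)) has_real_derivative b) (at y within {t. (x, t) \<in> S})"
    by (simp add: has_field_derivative_def)
qed

lemma Ck_on_2E:
  assumes "Ck_on 2 S v"
  obtains vx vy vxx vxy vyx vyy where
    "\<forall>p\<in>S. (v has_derivative (\<lambda>h. vx p * fst h + vy p * snd h)) (at p within S)"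
    "\<forall>p\<in>S. (vx has_derivative (\<lambda>h. vxx p * fst h + vxy p * snd h)) (at p within S)"
    "\<forall>p\<in>S. (vy has_derivative (\<lambda>h. vyx p * fst h + vyy p * snd h)) (at p within S)"
    "continuous_on S v" "continuous_on S vx" "continuous_on S vy"
    "continuous_on S vxx" "continuous_on S vyy"
proof -
  obtain vx vy vxx vxy vyx vyy where *:
    "\<forall>p\<in>S. (v has_derivative (\<lambda>h. vx p * fst h + vy p * snd h)) (at p within S)"
    "\<forall>p\<in>S. (vx has_derivative (\<lambda>h. vxx p * fst h + vxy p * snd h)) (at p within S)"
    "\<forall>p\<in>S. (vy has_derivative (\<lambda>h. vyx p * fst h + vyy p * snd h)) (at p within S)"
    "continuous_on S vxx" "continuous_on S vyy"
    using assms unfolding numeral_2_eq_2 Ck_on.simps by blast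
  moreover have "continuous_on S v" "continuous_on S vx" "continuous_on S vy"
    using *(1-3) by (auto intro!: has_derivative_continuous_on)
  ultimately show thesis using that by blast
qed

lemma C2_partialsI:
  assumes "Omega \<subseteq> S"
    and "\<And>p. p \<in> S \<Longrightarrow> (v has_derivative (\<lambda>h. vx p * fst h + vy p * snd h)) (at p within S)"
    and "\<And>p. p \<in> S \<Longrightarrow> (vx has_derivative (\<lambda>h. vxx p * fst h + vxy p * snd h)) (at p within S)"
    and "\<And>p. p \<in> S \<Longrightarrow> (vy has_derivative (\<lambda>h. vyx p * fst h + vyy p * snd h)) (at p within S)"
    and "continuous_on S v" "continuous_on S vx" "continuous_on S vy"
      "continuous_on S vxx" "continuous_on S vyy"
  shows "C2_partials v vx vy vxx vyy"
proof -
  have "((\<lambda>s. h (s, y)) has_real_derivative hx) (at x) \<and> ((\<lambda>t. h (x, t)) has_real_derivative hy) (at y)"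
    if "(x, y) \<in> Omega" "(h has_derivative (\<lambda>k. hx * fst k + hy * snd k)) (at (x, y) within S)" for h hx hy x y
  proof -
    have "(h has_derivative (\<lambda>k. hx * fst k + hy * snd k)) (at (x, y) within Omega)"
      using that(2) assms(1) by (rule has_derivative_subset)
    hence "(h has_derivative (\<lambda>k. hx * fst k + hy * snd k)) (at (x, y) within UNIV)"
      using that(1) by (simp add: at_within_open[OF that(1)])
    from has_real_derivative_slice[OF this] show ?thesis by simp
  qed
  note slice = this
  have "continuous_on Omega h" if "continuous_on S h" for h :: "real \<times> real \<Rightarrow> real"
    using that assms(1) by (rule continuous_on_subset)
  moreover have "p \<in> S" if "p \<in> Omega" for p
    using that assms(1) by blast
  ultimately show ?thesis unfolding C2_partials_def
    using slice[OF _ assms(2)] slice[OF _ assms(3)] slice[OF _ assms(4)] assms(5-) by blast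
qed

text \<open>Comparison is applied with a barrier satisfying the differential inequality strictly, so that
  the second-order test at an interior minimum suffices.\<close>

lemma second_derivative_nonneg_at_min:
  fixes g h :: "real \<Rightarrow> real"
  assumes "a < x" "x < b" "\<And>s. a < s \<Longrightarrow> s < b \<Longrightarrow> (g has_real_derivative h s) (at s)"
    and "(h has_real_derivative l) (at x)"
    and "\<And>s. a < s \<Longrightarrow> s < b \<Longrightarrow> g x \<le> g s"
  shows "h x = 0" "l \<ge> 0"
proof -
  define e where "e = min (x - a) (b - x)"
  have e: "e > 0" using assms by (auto simp: e_def)
  show h0: "h x = 0"
    by (rule DERIV_local_min[OF assms(3)[OF assms(1,2)] e]) (use assms(5) in \<open>auto simp: e_def\<close>)
  show "l \<ge> 0"
  proof (rule ccontr)
    assume "\<not> l \<ge> 0"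
    \<comment> \<open>As h vanishes at x, a negative slope makes h negative just to the right of x,
      and the mean value theorem then pushes g below its minimum.\<close>
    from DERIV_neg_dec_right[OF assms(4)] this obtain d where d: "d > 0" "\<And>k. k > 0 \<Longrightarrow> k < d \<Longrightarrow> h (x + k) < h x"
      by auto
    define k where "k = min d e / 2"
    have k: "k > 0" "k < d" "k < e" using d(1) e by (auto simp: k_def)
    have in_ab: "a < s \<and> s < b" if "x \<le> s" "s \<le> x + k" for s
      using that k assms(1) by (auto simp: e_def)
    have "\<exists>z>x. z < x + k \<and> g (x + k) - g x = (x + k - x) * h z"
      by (rule MVT2) (use k in_ab assms(3) in auto)
    then obtain z where z: "x < z" "z < x + k" "g (x + k) - g x = k * h z" by auto
    have "h z < 0" using d(2)[of "z - x"] z k h0 by auto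
    hence "k * h z < 0" using k by (simp add: mult_pos_neg)
    moreover have "g x \<le> g (x + k)" using assms(5) in_ab[of "x + k"] k by auto
    ultimately show False using z(3) by auto
  qed
qed

text \<open>A negative minimum would lie in the open square, where the gradient vanishes and removes
  the drift, while the second derivatives make the operator nonpositive.\<close>

lemma strict_comparison_nonneg:
  assumes C2: "C2_partials v vx vy vxx vyy" and cont: "continuous_on (closure Omega) v"
    and \<epsilon>: "\<epsilon> > 0"
    and L: "\<And>p. p \<in> Omega \<Longrightarrow> - \<epsilon> * (vxx p + vyy p) - b1 p * vx p - b2 p * vy p > 0"
    and bd: "\<And>p. p \<in> frontier Omega \<Longrightarrow> v p \<ge> 0"
    and p: "p \<in> closure Omega"
  shows "v p \<ge> 0"
proof (rule ccontr)
  assume neg: "\<not> v p \<ge> 0"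
  have "closure Omega \<noteq> {}" using p by auto
  then obtain q where q: "q \<in> closure Omega" "\<And>r. r \<in> closure Omega \<Longrightarrow> v q \<le> v r"
    using continuous_attains_inf[OF compact_closure_Omega _ cont] by auto
  have "v q < 0" using q(2)[OF p] neg by simp
  hence "q \<in> Omega" using bd[of q] q(1) by (force simp: frontier_Omega)
  then obtain x y where xy: "q = (x, y)" "(x, y) \<in> Omega" by (cases q) auto
  have le: "v q \<le> v (s, t)" if "(s, t) \<in> Omega" for s t
    using q(2)[of "(s, t)"] that by auto
  note C2' = C2[unfolded C2_partials_def]
  have "vx (x, y) = 0 \<and> vxx (x, y) \<ge> 0"
    using second_derivative_nonneg_at_min[of 0 x 1 "\<lambda>s. v (s, y)" "\<lambda>s. vx (s, y)" "vxx (x, y)"] C2' xy le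
    by auto
  moreover have "vy (x, y) = 0 \<and> vyy (x, y) \<ge> 0"
    using second_derivative_nonneg_at_min[of 0 y 1 "\<lambda>t. v (x, t)" "\<lambda>t. vy (x, t)" "vyy (x, y)"] C2' xy le
    by auto
  moreover have "\<epsilon> * (vxx (x, y) + vyy (x, y)) \<ge> 0" using calculation \<epsilon> by simp
  ultimately show False using L[OF xy(2)] by simp
qed

text \<open>The minimum principle applied to z + w and z - w; the factor s = 1 or s = -1 treats both
  at once.\<close>

lemma comparison:
  assumes w: "C2_partials w wx wy wxx wyy" "continuous_on (closure Omega) w"
      "\<And>p. p \<in> frontier Omega \<Longrightarrow> w p = 0"
    and z: "C2_partials z zx zy zxx zyy" "continuous_on (closure Omega) z"
      "\<And>p. p \<in> frontier Omega \<Longrightarrow> z p \<ge> 0"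
    and \<epsilon>: "\<epsilon> > 0"
    and L: "\<And>p. p \<in> Omega \<Longrightarrow> \<bar>- \<epsilon> * (wxx p + wyy p) - b1 p * wx p - b2 p * wy p\<bar>
        < - \<epsilon> * (zxx p + zyy p) - b1 p * zx p - b2 p * zy p"
    and p: "p \<in> closure Omega"
  shows "\<bar>w p\<bar> \<le> z p"
proof -
  have L': "- \<epsilon> * (zxx q + s * wxx q + (zyy q + s * wyy q)) - b1 q * (zx q + s * wx q) - b2 q * (zy q + s * wy q) > 0"
    if "q \<in> Omega" "s = 1 \<or> s = -1" for q s
    using that(2) L[OF that(1)] by (auto simp: algebra_simps abs_if split: if_splits)
  have *: "z p + s * w p \<ge> 0" if s: "s = 1 \<or> s = -1" for s
  proof (rule strict_comparison_nonneg[OF C2_partials_add[OF z(1) C2_partials_cmult[OF w(1)]] _ \<epsilon> _ _ p])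
    show "continuous_on (closure Omega) (\<lambda>p. z p + s * w p)"
      using w(2) z(2) by (intro continuous_intros)
    show "z q + s * w q \<ge> 0" if "q \<in> frontier Omega" for q
      using w(3) z(3) that by simp
  qed (use L' s in blast)
  show ?thesis using *[of 1] *[of "-1"] by simp
qed

section \<open>Truncated energy identity\<close>

abbreviation square :: "real \<Rightarrow> (real \<times> real) set" where
  "square a \<equiv> cbox (a, a) (1 - a, 1 - a)"

lemma mem_square [simp]: "(x, y) \<in> square a \<longleftrightarrow> a \<le> x \<and> x \<le> 1 - a \<and> a \<le> y \<and> y \<le> 1 - a"
  by (auto simp: cbox_Pair_eq)

lemma square_subset_Omega: "0 < a \<Longrightarrow> square a \<subseteq> Omega"
  by (auto simp: cbox_Pair_eq)

section \<open>Integration by parts on compact squares\<close>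

text \<open>Together with \<open>integral_dx_eq_0\<close> this is the divergence theorem on a square
  for a field without flux through the edges. Splitting it by components asks of each component only
  the partial derivative that enters the divergence.\<close>

lemma integral_dy_eq_0:
  fixes F G :: "real \<times> real \<Rightarrow> real"
  assumes "a \<le> b" "continuous_on (cbox (a, a) (b, b)) G"
    and "\<And>x y. x \<in> {a..b} \<Longrightarrow> y \<in> {a..b} \<Longrightarrow> ((\<lambda>t. F (x, t)) has_real_derivative G (x, y)) (at y)"
    and "\<And>x. x \<in> {a..b} \<Longrightarrow> F (x, a) = 0 \<and> F (x, b) = 0"
  shows "integral (cbox (a, a) (b, b)) G = 0"
proof -
  have "integral (cbox a b) (\<lambda>y. G (x, y)) = 0" if "x \<in> cbox a b" for x
  proof -
    have "((\<lambda>y. G (x, y)) has_integral (F (x, b) - F (x, a))) {a..b}"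
      by (rule fundamental_theorem_of_calculus[OF assms(1)])
        (use assms(3) that in \<open>auto simp: has_real_derivative_iff_has_vector_derivative[symmetric]
          intro: has_field_derivative_at_within\<close>)
    thus ?thesis using assms(4) that by (simp add: integral_unique)
  qed
  hence "integral (cbox a b) (\<lambda>x. integral (cbox a b) (\<lambda>y. G (x, y))) = integral (cbox a b) (\<lambda>_. 0)"
    by (rule integral_cong)
  thus ?thesis unfolding integral_prod_continuous[OF assms(2)] by simp
qed

lemma integral_dx_eq_0:
  fixes F G :: "real \<times> real \<Rightarrow> real"
  assumes "a \<le> b" "continuous_on (cbox (a, a) (b, b)) G"
    and "\<And>x y. x \<in> {a..b} \<Longrightarrow> y \<in> {a..b} \<Longrightarrow> ((\<lambda>s. F (s, y)) has_real_derivative G (x, y)) (at x)"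
    and "\<And>y. y \<in> {a..b} \<Longrightarrow> F (a, y) = 0 \<and> F (b, y) = 0"
  shows "integral (cbox (a, a) (b, b)) G = 0"
proof -
  have c: "continuous_on (cbox (a, a) (b, b)) (\<lambda>p. G (prod.swap p))"
    by (rule continuous_on_compose2[OF assms(2) continuous_on_swap]) (auto simp: cbox_Pair_eq)
  have "integral (cbox (a, a) (b, b)) (\<lambda>p. G (prod.swap p)) = 0"
    by (rule integral_dy_eq_0[OF assms(1) c, where F = "\<lambda>p. F (prod.swap p)"]) (use assms in auto)
  thus ?thesis
    using integral_swap_continuous[of a a b b "\<lambda>x y. G (x, y)"] assms(2)
      integral_prod_continuous[OF assms(2)] integral_prod_continuous[OF c] by simp
qed

section \<open>Convex truncation\<close>

text \<open>The kink of the ramp at s = c does no harm because g vanishes there to first order: the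
  difference quotient of the composition is dominated by that of g at 0.\<close>

lemma DERIV_compose_ramp:
  fixes g g' :: "real \<Rightarrow> real"
  assumes g: "\<And>m. m \<ge> 0 \<Longrightarrow> (g has_real_derivative g' m) (at m)" and "g 0 = 0" "g' 0 = 0"
  shows "((\<lambda>s. g (max 0 (s - c))) has_real_derivative g' (max 0 (s - c))) (at s)"
proof -
  consider "s < c" | "s > c" | "s = c" by linarith
  thus ?thesis
  proof cases
    case 1
    have "((\<lambda>s. g (max 0 (s - c))) has_real_derivative 0) (at s)"
      by (rule has_field_derivative_transform_within_open[where f = "\<lambda>_. 0" and S = "{..<c}"])
        (use 1 assms in auto)
    thus ?thesis using 1 assms by simp
  next
    case 2
    have "((\<lambda>s. s - c) has_real_derivative 1) (at s)" by (auto intro!: derivative_eq_intros)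
    from DERIV_chain2[where f = g and g = "\<lambda>s. s - c", OF g[of "s - c"] this] 2
    have "((\<lambda>s. g (s - c)) has_real_derivative g' (s - c)) (at s)" by simp
    hence "((\<lambda>s. g (max 0 (s - c))) has_real_derivative g' (s - c)) (at s)"
      by (rule has_field_derivative_transform_within_open[where S = "{c<..}"]) (use 2 in auto)
    thus ?thesis using 2 by simp
  next
    case 3
    have "(\<lambda>h. g h / h) \<midarrow>0\<rightarrow> 0"
      using g[of 0] assms by (simp add: DERIV_def)
    hence "(\<lambda>h. norm (g h / h)) \<midarrow>0\<rightarrow> 0" by (rule tendsto_norm_zero)
    hence "(\<lambda>h. g (max 0 h) / h) \<midarrow>0\<rightarrow> 0"
    proof (rule Lim_null_comparison[rotated])
      have "norm (g (max 0 h) / h) \<le> norm (g h / h)" for h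
      proof (cases "h \<ge> 0")
        case False
        hence "g (max 0 h) = 0" using assms by (simp add: max_def)
        thus ?thesis by simp
      qed (simp add: max_def)
      thus "\<forall>\<^sub>F h in at 0. norm (g (max 0 h) / h) \<le> norm (g h / h)" by simp
    qed
    thus ?thesis using 3 assms by (simp add: DERIV_def)
  qed
qed

text \<open>With \<open>m = max 0 (s - \<delta>)\<close>, the function \<open>trunc_sq \<delta> m\<close> is a convex \<open>C\<^sup>2\<close> approximation of \<open>s\<^sup>2 / 2\<close> for
  \<open>s > 0\<close> that vanishes for \<open>s \<le> \<delta>\<close>.\<close>

definition trunc_sq :: "real \<Rightarrow> real \<Rightarrow> real" where
  "trunc_sq \<delta> m = m ^ 3 / (2 * (m + \<delta>))"

definition trunc_sq' :: "real \<Rightarrow> real \<Rightarrow> real" where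
  "trunc_sq' \<delta> m = (2 * m ^ 3 + 3 * \<delta> * m\<^sup>2) / (2 * (m + \<delta>)\<^sup>2)"

text \<open>In this form it is visible that the second derivative is 0 at m = 0, increases with m,
  and exceeds 1/2 from m = \<delta> on.\<close>

definition trunc_sq'' :: "real \<Rightarrow> real \<Rightarrow> real" where
  "trunc_sq'' \<delta> m = 1 - (\<delta> / (m + \<delta>)) ^ 3"

lemma DERIV_trunc_sq:
  assumes "\<delta> > 0" "m \<ge> 0"
  shows "(trunc_sq \<delta> has_real_derivative trunc_sq' \<delta> m) (at m)"
    and "(trunc_sq' \<delta> has_real_derivative trunc_sq'' \<delta> m) (at m)"
proof -
  have nz: "m + \<delta> \<noteq> 0" using assms by auto
  have "((\<lambda>m. m ^ 3 / (2 * (m + \<delta>))) has_real_derivative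
      (3 * m\<^sup>2 * (2 * (m + \<delta>)) - m ^ 3 * 2) / (2 * (m + \<delta>) * (2 * (m + \<delta>)))) (at m)"
    by (rule DERIV_divide) (use nz in \<open>auto intro!: derivative_eq_intros\<close>)
  moreover have "(3 * m\<^sup>2 * (2 * (m + \<delta>)) - m ^ 3 * 2) / (2 * (m + \<delta>) * (2 * (m + \<delta>))) = trunc_sq' \<delta> m"
    unfolding trunc_sq'_def using nz
    by (simp add: frac_eq_eq) (simp add: power2_eq_square power3_eq_cube algebra_simps)
  ultimately show "(trunc_sq \<delta> has_real_derivative trunc_sq' \<delta> m) (at m)"
    by (simp add: trunc_sq_def[abs_def])
  have "((\<lambda>m. (2 * m ^ 3 + 3 * \<delta> * m\<^sup>2) / (2 * (m + \<delta>)\<^sup>2)) has_real_derivative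
      ((6 * m\<^sup>2 + 6 * \<delta> * m) * (2 * (m + \<delta>)\<^sup>2) - (2 * m ^ 3 + 3 * \<delta> * m\<^sup>2) * (4 * (m + \<delta>)))
        / (2 * (m + \<delta>)\<^sup>2 * (2 * (m + \<delta>)\<^sup>2))) (at m)"
    by (rule DERIV_divide) (use nz in \<open>auto intro!: derivative_eq_intros\<close>)
  moreover have "((6 * m\<^sup>2 + 6 * \<delta> * m) * (2 * (m + \<delta>)\<^sup>2) - (2 * m ^ 3 + 3 * \<delta> * m\<^sup>2) * (4 * (m + \<delta>)))
        / (2 * (m + \<delta>)\<^sup>2 * (2 * (m + \<delta>)\<^sup>2)) = ((m + \<delta>) ^ 3 - \<delta> ^ 3) / (m + \<delta>) ^ 3"
    using nz by (simp add: frac_eq_eq) (simp add: eval_nat_numeral algebra_simps)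
  moreover have "((m + \<delta>) ^ 3 - \<delta> ^ 3) / (m + \<delta>) ^ 3 = trunc_sq'' \<delta> m"
    unfolding trunc_sq''_def using nz by (simp add: diff_divide_distrib power_divide)
  ultimately show "(trunc_sq' \<delta> has_real_derivative trunc_sq'' \<delta> m) (at m)"
    by (simp add: trunc_sq'_def[abs_def])
qed

lemma trunc_sq_bounds:
  assumes "\<delta> > 0" "m \<ge> 0"
  shows "0 \<le> trunc_sq \<delta> m" "trunc_sq \<delta> m \<le> m\<^sup>2 / 2" "0 \<le> trunc_sq' \<delta> m" "trunc_sq' \<delta> m \<le> m"
    "0 \<le> trunc_sq'' \<delta> m" "m \<ge> \<delta> \<Longrightarrow> 1 / 2 \<le> trunc_sq'' \<delta> m"
proof -
  show "0 \<le> trunc_sq \<delta> m" "0 \<le> trunc_sq' \<delta> m"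
    using assms by (auto simp: trunc_sq_def trunc_sq'_def)
  have "m ^ 3 \<le> m\<^sup>2 * (m + \<delta>)"
    using assms by (simp add: power2_eq_square power3_eq_cube algebra_simps)
  thus "trunc_sq \<delta> m \<le> m\<^sup>2 / 2"
    using assms by (simp add: trunc_sq_def field_simps)
  have "0 \<le> \<delta> * m\<^sup>2 + 2 * \<delta>\<^sup>2 * m" using assms by simp
  hence "2 * m ^ 3 + 3 * \<delta> * m\<^sup>2 \<le> m * (2 * (m + \<delta>)\<^sup>2)"
    by (simp add: power2_eq_square power3_eq_cube algebra_simps)
  thus "trunc_sq' \<delta> m \<le> m"
    using assms by (simp add: trunc_sq'_def divide_le_eq)
  have "(\<delta> / (m + \<delta>)) ^ 3 \<le> 1 ^ 3"
    using assms by (intro power_mono) auto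
  thus "0 \<le> trunc_sq'' \<delta> m" by (simp add: trunc_sq''_def)
  assume "m \<ge> \<delta>"
  hence "(\<delta> / (m + \<delta>)) ^ 3 \<le> (1 / 2) ^ 3"
    using assms by (intro power_mono) (auto simp: field_simps)
  also have "\<dots> \<le> (1 / 2 :: real)" by (simp add: power3_eq_cube)
  finally have "(\<delta> / (m + \<delta>)) ^ 3 \<le> 1 / 2" .
  thus "1 / 2 \<le> trunc_sq'' \<delta> m" unfolding trunc_sq''_def by linarith
qed

text \<open>Test the equation with \<Psi>'(v), where \<Psi>(v) is the truncation of v^2 / 2. The
  right-hand side contributes at most M J because 0 \<le> \<Psi>'(v) \<le> M, and the divergence of
  b at most D M^2 / 2 because \<Psi>(v) \<le> M^2 / 2 on a set of measure at most 1. An upper bound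
  of v suffices, since the truncation sees only positive values.\<close>

lemma energy_estimate:
  fixes v :: "real \<times> real \<Rightarrow> real"
  assumes v: "C2_partials v vx vy vxx vyy" "continuous_on (closure Omega) v"
      "\<And>p. p \<in> frontier Omega \<Longrightarrow> v p = 0"
    and b: "continuous_on Omega b1" "continuous_on Omega b2" "continuous_on Omega b1x" "continuous_on Omega b2y"
      "\<And>x y. (x, y) \<in> Omega \<Longrightarrow> ((\<lambda>s. b1 (s, y)) has_real_derivative b1x (x, y)) (at x)"
      "\<And>x y. (x, y) \<in> Omega \<Longrightarrow> ((\<lambda>t. b2 (x, t)) has_real_derivative b2y (x, y)) (at y)"
      "\<And>p. p \<in> Omega \<Longrightarrow> \<bar>b1x p + b2y p\<bar> \<le> D"
    and M: "\<And>p. p \<in> Omega \<Longrightarrow> v p \<le> M" "M \<ge> 0"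
    and r: "\<And>p. p \<in> Omega \<Longrightarrow> \<bar>- \<epsilon> * (vxx p + vyy p) - b1 p * vx p - b2 p * vy p\<bar> \<le> r p"
      "continuous_on Omega r" "\<And>a. 0 < a \<Longrightarrow> a < 1/2 \<Longrightarrow> integral (square a) r \<le> J"
    and pos: "\<epsilon> > 0" "\<delta> > 0" "0 < a" "a < 1/2"
  shows "\<epsilon> * integral (square a) (\<lambda>p. trunc_sq'' \<delta> (max 0 (v p - \<delta>)) * ((vx p)\<^sup>2 + (vy p)\<^sup>2))
    \<le> M * J + D * M\<^sup>2 / 2"
proof -
  define P where "P p = trunc_sq \<delta> (max 0 (v p - \<delta>))" for p
  define P1 where "P1 p = trunc_sq' \<delta> (max 0 (v p - \<delta>))" for p
  define P2 where "P2 p = trunc_sq'' \<delta> (max 0 (v p - \<delta>))" for p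
  note v' = v(1)[unfolded C2_partials_def]
  have DP: "((\<lambda>s. trunc_sq \<delta> (max 0 (s - \<delta>))) has_real_derivative trunc_sq' \<delta> (max 0 (s - \<delta>))) (at s)"
    "((\<lambda>s. trunc_sq' \<delta> (max 0 (s - \<delta>))) has_real_derivative trunc_sq'' \<delta> (max 0 (s - \<delta>))) (at s)" for s
    using pos(2) by (intro DERIV_compose_ramp DERIV_trunc_sq; simp add: trunc_sq_def trunc_sq'_def trunc_sq''_def)+
  have contP: "continuous_on Omega P" "continuous_on Omega P1" "continuous_on Omega P2"
  proof -
    have c: "continuous_on UNIV (\<lambda>s. trunc_sq \<delta> (max 0 (s - \<delta>)))"
      "continuous_on UNIV (\<lambda>s. trunc_sq' \<delta> (max 0 (s - \<delta>)))"
      by (rule DERIV_continuous_on[OF has_field_derivative_at_within] DP)+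
    have "max 0 (s - \<delta>) + \<delta> \<noteq> 0" for s using pos by (auto simp: max_def)
    hence "continuous_on UNIV (\<lambda>s. trunc_sq'' \<delta> (max 0 (s - \<delta>)))"
      unfolding trunc_sq''_def by (intro continuous_intros) auto
    with c show "continuous_on Omega P" "continuous_on Omega P1" "continuous_on Omega P2"
      unfolding P_def[abs_def] P1_def[abs_def] P2_def[abs_def] using v'
      by (auto intro: continuous_on_compose2)
  qed
  have "uniformly_continuous_on (closure Omega) v"
    using v(2) compact_closure_Omega by (rule compact_uniformly_continuous)
  then obtain d where d: "d > 0"
    "\<And>p q. p \<in> closure Omega \<Longrightarrow> q \<in> closure Omega \<Longrightarrow> dist q p < d \<Longrightarrow> dist (v q) (v p) < \<delta>"
    unfolding uniformly_continuous_on_def using pos(2) by metis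
  \<comment> \<open>The edges of \<open>square a'\<close> are closer than d to the frontier, so v
    \<le> \<delta> there and all boundary terms vanish; \<open>square a\<close> is contained in
    \<open>square a'\<close>.\<close>
  define a' where "a' = min a (d / 2)"
  have a': "0 < a'" "a' \<le> a" "a' < d" "a' < 1/2" using pos d(1) by (auto simp: a'_def)
  have small: "v q \<le> \<delta>" if "q \<in> closure Omega" "p \<in> frontier Omega" "dist q p < d" for p q
    using d(2)[of p q] v(3)[of p] that by (auto simp: frontier_Omega dist_real_def)
  have P0: "P p = 0" "P1 p = 0" if "v p \<le> \<delta>" for p
    using that by (simp_all add: P_def P1_def trunc_sq_def trunc_sq'_def)
  have edge: "v (a', y) \<le> \<delta>" "v (1 - a', y) \<le> \<delta>" "v (y, a') \<le> \<delta>" "v (y, 1 - a') \<le> \<delta>"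
    if "y \<in> {a'..1 - a'}" for y
    using that a' small[of "(a', y)" "(0, y)"] small[of "(1 - a', y)" "(1, y)"]
      small[of "(y, a')" "(y, 0)"] small[of "(y, 1 - a')" "(y, 1)"]
    by (auto simp: frontier_Omega dist_Pair_Pair dist_real_def)
  \<comment> \<open>The two summands of the divergence of \<epsilon> \<Psi>'(v) \<nabla>v +
    \<Psi>(v) b.\<close>
  define G1 where "G1 p = \<epsilon> * (P2 p * vx p * vx p + vxx p * P1 p) + (b1x p * P p + P1 p * vx p * b1 p)" for p
  define G2 where "G2 p = \<epsilon> * (P2 p * vy p * vy p + vyy p * P1 p) + (b2y p * P p + P1 p * vy p * b2 p)" for p
  have contG: "continuous_on Omega G1" "continuous_on Omega G2"
    unfolding G1_def G2_def using v' b contP by (auto intro!: continuous_intros)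
  have sub: "square a' \<subseteq> Omega" using a' by (intro square_subset_Omega)
  have G1: "integral (square a') G1 = 0"
  proof (rule integral_dx_eq_0[where F = "\<lambda>p. \<epsilon> * (P1 p * vx p) + b1 p * P p"])
    fix x y assume "x \<in> {a'..1 - a'}" "y \<in> {a'..1 - a'}"
    hence xy: "(x, y) \<in> Omega" using a' by auto
    hence vd: "((\<lambda>s. v (s, y)) has_real_derivative vx (x, y)) (at x)"
      "((\<lambda>s. vx (s, y)) has_real_derivative vxx (x, y)) (at x)" using v' by blast+
    have "((\<lambda>s. P (s, y)) has_real_derivative P1 (x, y) * vx (x, y)) (at x)"
      "((\<lambda>s. P1 (s, y)) has_real_derivative P2 (x, y) * vx (x, y)) (at x)"
      unfolding P_def P1_def P2_def by (rule DERIV_chain2[OF DP(1) vd(1)] DERIV_chain2[OF DP(2) vd(1)])+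
    from DERIV_add[OF DERIV_cmult[OF DERIV_mult[OF this(2) vd(2)], of \<epsilon>] DERIV_mult[OF b(5)[OF xy] this(1)]]
    show "((\<lambda>s. \<epsilon> * (P1 (s, y) * vx (s, y)) + b1 (s, y) * P (s, y)) has_real_derivative G1 (x, y)) (at x)"
      by (simp add: G1_def)
  qed (use a' contG sub in \<open>auto simp: P0 edge intro: continuous_on_subset\<close>)
  have G2: "integral (square a') G2 = 0"
  proof (rule integral_dy_eq_0[where F = "\<lambda>p. \<epsilon> * (P1 p * vy p) + b2 p * P p"])
    fix x y assume "x \<in> {a'..1 - a'}" "y \<in> {a'..1 - a'}"
    hence xy: "(x, y) \<in> Omega" using a' by auto
    hence vd: "((\<lambda>t. v (x, t)) has_real_derivative vy (x, y)) (at y)"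
      "((\<lambda>t. vy (x, t)) has_real_derivative vyy (x, y)) (at y)" using v' by blast+
    have "((\<lambda>t. P (x, t)) has_real_derivative P1 (x, y) * vy (x, y)) (at y)"
      "((\<lambda>t. P1 (x, t)) has_real_derivative P2 (x, y) * vy (x, y)) (at y)"
      unfolding P_def P1_def P2_def by (rule DERIV_chain2[OF DP(1) vd(1)] DERIV_chain2[OF DP(2) vd(1)])+
    from DERIV_add[OF DERIV_cmult[OF DERIV_mult[OF this(2) vd(2)], of \<epsilon>] DERIV_mult[OF b(6)[OF xy] this(1)]]
    show "((\<lambda>t. \<epsilon> * (P1 (x, t) * vy (x, t)) + b2 (x, t) * P (x, t)) has_real_derivative G2 (x, y)) (at y)"
      by (simp add: G2_def)
  qed (use a' contG sub in \<open>auto simp: P0 edge intro: continuous_on_subset\<close>)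
  define E where "E p = P2 p * ((vx p)\<^sup>2 + (vy p)\<^sup>2)" for p
  have contE: "continuous_on Omega E"
    unfolding E_def using v' contP by (auto intro!: continuous_intros)
  have int: "h integrable_on square c" if "continuous_on Omega h" "c > 0" for h :: "real \<times> real \<Rightarrow> real" and c
    by (rule integrable_continuous, rule continuous_on_subset[OF that(1)]) (use that square_subset_Omega in auto)
  have D0: "D \<ge> 0" using b(7)[of "(1/2, 1/2)"] by simp
  have pw: "\<epsilon> * E p \<le> G1 p + G2 p + (M * r p + D * M\<^sup>2 / 2)" if "p \<in> Omega" for p
  proof -
    have m: "0 \<le> max 0 (v p - \<delta>)" "max 0 (v p - \<delta>) \<le> M" using M(1)[OF that] M(2) pos by auto
    note tb = trunc_sq_bounds[OF pos(2) m(1)]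
    have P1b: "0 \<le> P1 p" "P1 p \<le> M" using tb m by (auto simp: P1_def)
    have "(max 0 (v p - \<delta>))\<^sup>2 \<le> M\<^sup>2" using m by (intro power_mono)
    hence Pb: "0 \<le> P p" "P p \<le> M\<^sup>2 / 2" using tb by (auto simp: P_def)
    have "P1 p * (- \<epsilon> * (vxx p + vyy p) - b1 p * vx p - b2 p * vy p) \<le> P1 p * r p"
      using r(1)[OF that] P1b by (intro mult_left_mono) auto
    also have "\<dots> \<le> M * r p" using r(1)[OF that] P1b by (intro mult_right_mono) auto
    finally have 1: "P1 p * (- \<epsilon> * (vxx p + vyy p) - b1 p * vx p - b2 p * vy p) \<le> M * r p" .
    have "- (b1x p + b2y p) * P p \<le> D * P p" using b(7)[OF that] Pb by (intro mult_right_mono) auto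
    also have "\<dots> \<le> D * (M\<^sup>2 / 2)" using Pb D0 by (intro mult_left_mono)
    finally have 2: "- (b1x p + b2y p) * P p \<le> D * M\<^sup>2 / 2" by simp
    \<comment> \<open>Pointwise energy identity: \<epsilon> \<Psi>''(v) |\<nabla>v|^2 is a
      divergence, plus \<Psi>'(v) times the operator applied to v, minus (div b) \<Psi>(v).\<close>
    have "\<epsilon> * E p = G1 p + G2 p + (P1 p * (- \<epsilon> * (vxx p + vyy p) - b1 p * vx p - b2 p * vy p)
        + (- (b1x p + b2y p) * P p))"
      by (simp add: E_def G1_def G2_def algebra_simps power2_eq_square)
    thus ?thesis using 1 2 by linarith
  qed
  have E0: "0 \<le> E p" for p
    using trunc_sq_bounds(5)[OF pos(2), of "max 0 (v p - \<delta>)"] by (simp add: E_def P2_def)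
  have "integral (square a) E \<le> integral (square a') E"
    by (rule integral_subset_le) (use a' pos E0 int[OF contE] in \<open>auto simp: cbox_Pair_eq\<close>)
  hence "\<epsilon> * integral (square a) E \<le> integral (square a') (\<lambda>p. \<epsilon> * E p)"
    using pos by simp
  also have "\<dots> \<le> integral (square a') (\<lambda>p. G1 p + G2 p + (M * r p + D * M\<^sup>2 / 2))"
    using sub pw a' contE contG r(2)
    by (intro integral_le int) (auto intro!: continuous_intros)
  also have "\<dots> = integral (square a') G1 + integral (square a') G2
      + (integral (square a') (\<lambda>p. M * r p) + integral (square a') (\<lambda>_. D * M\<^sup>2 / 2))"
    using a' contG r(2) by (subst integral_add integral_add int | auto intro!: int continuous_intros)+
  also have "\<dots> = M * integral (square a') r + measure lborel (square a') * (D * M\<^sup>2 / 2)"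
    using G1 G2 by simp
  also have "\<dots> \<le> M * J + 1 * (D * M\<^sup>2 / 2)"
  proof (intro add_mono mult_left_mono[OF r(3)] mult_right_mono)
    have "measure lborel (square a') = (1 - 2 * a') * (1 - 2 * a')" using a' by (simp add: content_Pair)
    also have "\<dots> \<le> 1 * 1" using a' by (intro mult_mono) auto
    finally show "measure lborel (square a') \<le> 1" by simp
  qed (use a' M D0 in auto)
  finally show ?thesis by (simp add: E_def[abs_def] P2_def[abs_def])
qed

section \<open>Residuals of the correctors\<close>

text \<open>One predicate for the cut-offs and for the edge traces of u0, b1 and b2: every corrector
  is built from such functions of one variable, with a common bound K.\<close>

definition C2_bounded :: "real \<Rightarrow> (real \<Rightarrow> real) \<Rightarrow> (real \<Rightarrow> real) \<Rightarrow> (real \<Rightarrow> real) \<Rightarrow> bool" where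
  "C2_bounded K g g1 g2 \<longleftrightarrow>
     (\<forall>s\<in>{0<..<1}. (g has_real_derivative g1 s) (at s) \<and> (g1 has_real_derivative g2 s) (at s)
        \<and> \<bar>g s\<bar> \<le> K \<and> \<bar>g1 s\<bar> \<le> K \<and> \<bar>g2 s\<bar> \<le> K)
   \<and> continuous_on {0<..<1} g2"

lemma C2_bounded_continuous:
  assumes "C2_bounded K g g1 g2"
  shows "continuous_on Omega (\<lambda>p. g (fst p))" "continuous_on Omega (\<lambda>p. g1 (fst p))"
    "continuous_on Omega (\<lambda>p. g2 (fst p))" "continuous_on Omega (\<lambda>p. g (snd p))"
    "continuous_on Omega (\<lambda>p. g1 (snd p))" "continuous_on Omega (\<lambda>p. g2 (snd p))"
proof -
  have "(g has_real_derivative g1 s) (at s within {0<..<1})" "(g1 has_real_derivative g2 s) (at s within {0<..<1})"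
    if "s \<in> {0<..<1}" for s
    using assms that by (auto simp: C2_bounded_def intro: has_field_derivative_at_within)
  hence c: "continuous_on {0<..<1} g" "continuous_on {0<..<1} g1" "continuous_on {0<..<1} g2"
    using assms unfolding C2_bounded_def by (blast intro: DERIV_continuous_on)+
  have *: "continuous_on Omega (\<lambda>p. h (fst p)) \<and> continuous_on Omega (\<lambda>p. h (snd p))"
    if "continuous_on {0<..<1} h" for h :: "real \<Rightarrow> real"
    by (rule conjI; rule continuous_on_compose2[OF that]; auto intro!: continuous_intros simp: Omega_def)
  show "continuous_on Omega (\<lambda>p. g (fst p))" "continuous_on Omega (\<lambda>p. g1 (fst p))"
    "continuous_on Omega (\<lambda>p. g2 (fst p))" "continuous_on Omega (\<lambda>p. g (snd p))"
    "continuous_on Omega (\<lambda>p. g1 (snd p))" "continuous_on Omega (\<lambda>p. g2 (snd p))"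
    using *[OF c(1)] *[OF c(2)] *[OF c(3)] by auto
qed

text \<open>A normal derivative of the exponential costs \<beta> / \<epsilon>, a tangential one only
  \<beta>' y / \<epsilon>, which is bounded on the scale of the layer. The formulas keep the
  quotient y / \<epsilon> together to preserve this distinction.\<close>

lemma C2_partials_layer:
  fixes \<epsilon> :: real
  assumes \<sigma>: "C2_bounded K \<sigma> \<sigma>1 \<sigma>2" and g: "C2_bounded K g g1 g2" and \<beta>: "C2_bounded K \<beta> \<beta>1 \<beta>2"
    and \<epsilon>: "\<epsilon> > 0"
  defines "E \<equiv> \<lambda>p. exp (- \<beta> (fst p) * snd p / \<epsilon>)"
  shows "C2_partials (\<lambda>p. - \<sigma> (snd p) * g (fst p) * E p)
    (\<lambda>p. - \<sigma> (snd p) * (g1 (fst p) - g (fst p) * \<beta>1 (fst p) * (snd p / \<epsilon>)) * E p)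
    (\<lambda>p. - g (fst p) * (\<sigma>1 (snd p) - \<sigma> (snd p) * (\<beta> (fst p) / \<epsilon>)) * E p)
    (\<lambda>p. - \<sigma> (snd p) * (g2 (fst p) - 2 * g1 (fst p) * \<beta>1 (fst p) * (snd p / \<epsilon>)
        - g (fst p) * \<beta>2 (fst p) * (snd p / \<epsilon>) + g (fst p) * (\<beta>1 (fst p) * (snd p / \<epsilon>))\<^sup>2) * E p)
    (\<lambda>p. - g (fst p) * (\<sigma>2 (snd p) - 2 * \<sigma>1 (snd p) * (\<beta> (fst p) / \<epsilon>)
        + \<sigma> (snd p) * (\<beta> (fst p) / \<epsilon>)\<^sup>2) * E p)"
proof -
  note c = C2_bounded_continuous[OF \<sigma>] C2_bounded_continuous[OF g] C2_bounded_continuous[OF \<beta>]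
  have cE: "continuous_on Omega E"
    unfolding E_def using c \<epsilon> by (auto intro!: continuous_intros)
  have DE: "((\<lambda>s. E (s, y)) has_real_derivative - \<beta>1 x * (y / \<epsilon>) * E (x, y)) (at x)"
    "((\<lambda>t. E (x, t)) has_real_derivative - (\<beta> x / \<epsilon>) * E (x, y)) (at y)"
    if "(x, y) \<in> Omega" for x y
  proof -
    have "(\<beta> has_real_derivative \<beta>1 x) (at x)" using \<beta> that by (auto simp: C2_bounded_def)
    thus "((\<lambda>s. E (s, y)) has_real_derivative - \<beta>1 x * (y / \<epsilon>) * E (x, y)) (at x)"
      unfolding E_def using \<epsilon> by (auto intro!: derivative_eq_intros)
    show "((\<lambda>t. E (x, t)) has_real_derivative - (\<beta> x / \<epsilon>) * E (x, y)) (at y)"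
      unfolding E_def using \<epsilon> by (auto intro!: derivative_eq_intros)
  qed
  have D: "(\<sigma> has_real_derivative \<sigma>1 y) (at y)" "(\<sigma>1 has_real_derivative \<sigma>2 y) (at y)"
    "(g has_real_derivative g1 x) (at x)" "(g1 has_real_derivative g2 x) (at x)"
    "(\<beta>1 has_real_derivative \<beta>2 x) (at x)"
    if "(x, y) \<in> Omega" for x y
    using assms(1-3) that by (auto simp: C2_bounded_def)
  show ?thesis unfolding C2_partials_def
  proof (intro conjI allI impI)
    fix x y assume xy: "(x, y) \<in> Omega"
    note [derivative_intros] = DE[OF xy] D[OF xy]
    show "((\<lambda>s. - \<sigma> (snd (s, y)) * g (fst (s, y)) * E (s, y)) has_real_derivative
        - \<sigma> (snd (x, y)) * (g1 (fst (x, y)) - g (fst (x, y)) * \<beta>1 (fst (x, y)) * (snd (x, y) / \<epsilon>)) * E (x, y)) (at x)"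
      by (auto intro!: derivative_eq_intros simp: algebra_simps)
    show "((\<lambda>t. - \<sigma> (snd (x, t)) * g (fst (x, t)) * E (x, t)) has_real_derivative
        - g (fst (x, y)) * (\<sigma>1 (snd (x, y)) - \<sigma> (snd (x, y)) * (\<beta> (fst (x, y)) / \<epsilon>)) * E (x, y)) (at y)"
      by (auto intro!: derivative_eq_intros simp: algebra_simps)
    show "((\<lambda>s. - \<sigma> (snd (s, y)) * (g1 (fst (s, y)) - g (fst (s, y)) * \<beta>1 (fst (s, y)) * (snd (s, y) / \<epsilon>)) * E (s, y))
       has_real_derivative - \<sigma> (snd (x, y)) * (g2 (fst (x, y)) - 2 * g1 (fst (x, y)) * \<beta>1 (fst (x, y)) * (snd (x, y) / \<epsilon>)
        - g (fst (x, y)) * \<beta>2 (fst (x, y)) * (snd (x, y) / \<epsilon>)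
        + g (fst (x, y)) * (\<beta>1 (fst (x, y)) * (snd (x, y) / \<epsilon>))\<^sup>2) * E (x, y)) (at x)"
      using \<epsilon> by (auto intro!: derivative_eq_intros simp: field_simps power2_eq_square)
    show "((\<lambda>t. - g (fst (x, t)) * (\<sigma>1 (snd (x, t)) - \<sigma> (snd (x, t)) * (\<beta> (fst (x, t)) / \<epsilon>)) * E (x, t))
       has_real_derivative - g (fst (x, y)) * (\<sigma>2 (snd (x, y)) - 2 * \<sigma>1 (snd (x, y)) * (\<beta> (fst (x, y)) / \<epsilon>)
        + \<sigma> (snd (x, y)) * (\<beta> (fst (x, y)) / \<epsilon>)\<^sup>2) * E (x, y)) (at y)"
      using \<epsilon> by (auto intro!: derivative_eq_intros simp: field_simps power2_eq_square)
  qed (use \<epsilon> in \<open>auto intro!: continuous_intros c cE\<close>)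
qed

text \<open>Half of the decay rate is spent on the polynomial: 1, z and z^2 are bounded by multiples
  of exp (\<gamma> z) through its quadratic Taylor polynomial, and this is the origin of the
  constants 1 / \<gamma> and 2 / \<gamma>^2.\<close>

lemma quadratic_exp_le:
  fixes \<beta> \<gamma> z :: real
  assumes "\<gamma> > 0" "z \<ge> 0" "\<beta> \<ge> 2 * \<gamma>"
  shows "(1 + z + z\<^sup>2) * exp (- \<beta> * z) \<le> (1 + 1 / \<gamma> + 2 / \<gamma>\<^sup>2) * exp (- \<gamma> * z)"
proof -
  have "1 + \<gamma> * z + (\<gamma> * z)\<^sup>2 / 2 \<le> exp (\<gamma> * z)"
    using assms by (intro exp_lower_Taylor_quadratic) auto
  moreover have "0 \<le> \<gamma> * z" "0 \<le> (\<gamma> * z)\<^sup>2" using assms by auto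
  ultimately have 1: "1 \<le> exp (\<gamma> * z)" "\<gamma> * z \<le> exp (\<gamma> * z)" "(\<gamma> * z)\<^sup>2 \<le> 2 * exp (\<gamma> * z)"
    by linarith+
  have "z \<le> (1 / \<gamma>) * exp (\<gamma> * z)" "z\<^sup>2 \<le> (2 / \<gamma>\<^sup>2) * exp (\<gamma> * z)"
    using 1 assms by (simp_all add: field_simps power_mult_distrib)
  hence "1 + z + z\<^sup>2 \<le> (1 + 1 / \<gamma> + 2 / \<gamma>\<^sup>2) * exp (\<gamma> * z)"
    unfolding distrib_right using 1 by linarith
  moreover have "2 * \<gamma> * z \<le> \<beta> * z" using assms by (intro mult_right_mono)
  hence "exp (- \<beta> * z) \<le> exp (- 2 * \<gamma> * z)" by simp
  ultimately have "(1 + z + z\<^sup>2) * exp (- \<beta> * z) \<le> ((1 + 1 / \<gamma> + 2 / \<gamma>\<^sup>2) * exp (\<gamma> * z)) * exp (- 2 * \<gamma> * z)"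
    using assms by (intro mult_mono) auto
  also have "\<dots> = (1 + 1 / \<gamma> + 2 / \<gamma>\<^sup>2) * exp (- \<gamma> * z)"
    by (simp add: mult.assoc exp_add[symmetric])
  finally show ?thesis .
qed

lemma abs_mult_le:
  fixes a b :: real
  shows "\<bar>a\<bar> \<le> A \<Longrightarrow> \<bar>b\<bar> \<le> B \<Longrightarrow> \<bar>a * b\<bar> \<le> A * B"
  unfolding abs_mult by (intro mult_mono) auto

text \<open>The bracket left over after the exponential has cancelled the singular terms of order
  \<open>1 / \<epsilon>\<close> in the frozen-coefficient operator.\<close>

lemma layer_bracket_le:
  fixes \<epsilon> :: real
  assumes "\<bar>s0\<bar> \<le> K" "\<bar>s1\<bar> \<le> K" "\<bar>s2\<bar> \<le> K" "\<bar>\<beta>\<bar> \<le> K" "\<bar>c\<bar> \<le> K" "\<bar>\<beta> - c\<bar> \<le> K * d"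
    and "K \<ge> 1" "0 < \<epsilon>" "\<epsilon> \<le> 1"
  shows "\<bar>\<epsilon> * s2 + (c - 2 * \<beta>) * s1 + s0 * \<beta> * (\<beta> - c) / \<epsilon>\<bar> \<le> 4 * K ^ 3 * (1 + d / \<epsilon>)"
proof -
  have d: "d \<ge> 0" using assms(6,7) by (metis abs_ge_zero order_trans zero_le_mult_iff not_one_le_zero linorder_not_le order_less_le_trans zero_less_one)
  have "\<bar>\<epsilon> * s2\<bar> \<le> 1 * K" using assms by (intro abs_mult_le) auto
  moreover have "\<bar>(c - 2 * \<beta>) * s1\<bar> \<le> (3 * K) * K" using assms by (intro abs_mult_le) linarith+
  hence "\<bar>(c - 2 * \<beta>) * s1\<bar> \<le> 3 * (K * K)" by simp
  \<comment> \<open>The only term with 1 / \<epsilon> carries the freezing error \<beta> - c, whose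
    bound K d turns it into a multiple of d / \<epsilon>.\<close>
  moreover have "\<bar>s0 * \<beta> * (\<beta> - c)\<bar> \<le> K * K * (K * d)" using assms by (intro abs_mult_le)
  hence "\<bar>s0 * \<beta> * (\<beta> - c) / \<epsilon>\<bar> \<le> K ^ 3 * (d / \<epsilon>)"
    using assms by (simp add: divide_simps power3_eq_cube mult.assoc)
  moreover have "K \<le> K ^ 3" "K * K \<le> K ^ 3"
    using assms power_increasing[of 1 3 K] power_increasing[of 2 3 K] by (auto simp: power2_eq_square)
  moreover have "0 \<le> K ^ 3 * (d / \<epsilon>)" using assms d by simp
  moreover have "\<bar>A + B + C\<bar> \<le> \<bar>A\<bar> + \<bar>B\<bar> + \<bar>C\<bar>" for A B C :: real by linarith
  ultimately have "\<bar>\<epsilon> * s2 + (c - 2 * \<beta>) * s1 + s0 * \<beta> * (\<beta> - c) / \<epsilon>\<bar>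
      \<le> 1 * K + 3 * (K * K) + K ^ 3 * (d / \<epsilon>)"
    by (meson add_mono order_trans)
  also have "\<dots> \<le> 4 * K ^ 3 + 4 * (K ^ 3 * (d / \<epsilon>))"
    using \<open>K \<le> K ^ 3\<close> \<open>K * K \<le> K ^ 3\<close> \<open>0 \<le> K ^ 3 * (d / \<epsilon>)\<close> by linarith
  also have "\<dots> = 4 * K ^ 3 * (1 + d / \<epsilon>)" by (simp add: algebra_simps)
  finally show ?thesis .
qed

text \<open>The singular terms combine to \<beta> (\<beta> - c) / \<epsilon>, and \<beta> is the
  value of c on the edge, up to K y. What remains is a polynomial of degree two in z = y /
  \<epsilon> times exp (- \<beta> z), to which \<open>quadratic_exp_le\<close> applies. Here a is
  the tangential and c the normal coefficient.\<close>

lemma layer_residual_le: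
  fixes \<epsilon> K \<gamma> :: real
  assumes \<sigma>: "C2_bounded K \<sigma> \<sigma>1 \<sigma>2" and g: "C2_bounded K g g1 g2" and \<beta>: "C2_bounded K \<beta> \<beta>1 \<beta>2"
    and K: "K \<ge> 1" and \<epsilon>: "0 < \<epsilon>" "\<epsilon> \<le> 1"
    and \<gamma>: "\<gamma> > 0" "\<And>s. s \<in> {0<..<1} \<Longrightarrow> \<beta> s \<ge> 2 * \<gamma>"
    and a: "\<And>p. p \<in> Omega \<Longrightarrow> \<bar>a p\<bar> \<le> K" and c: "\<And>p. p \<in> Omega \<Longrightarrow> \<bar>c p\<bar> \<le> K"
    and Lip: "\<And>p. p \<in> Omega \<Longrightarrow> \<bar>\<beta> (fst p) - c p\<bar> \<le> K * snd p"
  obtains Tx Ty Txx Tyy where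
    "C2_partials (\<lambda>p. - \<sigma> (snd p) * g (fst p) * exp (- \<beta> (fst p) * snd p / \<epsilon>)) Tx Ty Txx Tyy"
    "\<And>p. p \<in> Omega \<Longrightarrow> \<bar>- \<epsilon> * (Txx p + Tyy p) - a p * Tx p - c p * Ty p\<bar>
       \<le> 8 * K ^ 4 * (1 + 1 / \<gamma> + 2 / \<gamma>\<^sup>2) * exp (- \<gamma> * snd p / \<epsilon>)"
proof (rule that[OF C2_partials_layer[OF \<sigma> g \<beta> \<epsilon>(1)]])
  fix p assume p: "p \<in> Omega"
  obtain x y where xy: "p = (x, y)" "x \<in> {0<..<1}" "y \<in> {0<..<1}" using p by (cases p) auto
  define z where "z = y / \<epsilon>"
  define E where "E = exp (- \<beta> x * z)"
  have z: "z \<ge> 0" using xy \<epsilon> by (simp add: z_def)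
  have s: "\<bar>\<sigma> y\<bar> \<le> K" "\<bar>\<sigma>1 y\<bar> \<le> K" "\<bar>\<sigma>2 y\<bar> \<le> K" using \<sigma> xy by (auto simp: C2_bounded_def)
  have gb: "\<bar>g x\<bar> \<le> K" "\<bar>g1 x\<bar> \<le> K" "\<bar>g2 x\<bar> \<le> K" using g xy by (auto simp: C2_bounded_def)
  have bb: "\<bar>\<beta> x\<bar> \<le> K" "\<bar>\<beta>1 x\<bar> \<le> K" "\<bar>\<beta>2 x\<bar> \<le> K" using \<beta> xy by (auto simp: C2_bounded_def)
  \<comment> \<open>The residual will be \<open>N * E\<close>: B1 collects the normal derivatives,
    B2 the second and B3 the first tangential derivative.\<close>
  define B1 where "B1 = \<epsilon> * \<sigma>2 y + (c p - 2 * \<beta> x) * \<sigma>1 y + \<sigma> y * \<beta> x * (\<beta> x - c p) / \<epsilon>"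
  define B2 where "B2 = g2 x - 2 * g1 x * \<beta>1 x * z - g x * \<beta>2 x * z + g x * (\<beta>1 x * z)\<^sup>2"
  define B3 where "B3 = g1 x - g x * \<beta>1 x * z"
  define N where "N = g x * B1 + \<epsilon> * (\<sigma> y * B2) + a p * \<sigma> y * B3"
  have zz: "\<bar>z\<bar> \<le> z" using z by simp
  have pw: "K ^ n \<le> K ^ m" if "n \<le> m" for n m using K that by (rule power_increasing[rotated])
  have "\<bar>B1\<bar> \<le> 4 * K ^ 3 * (1 + z)"
    unfolding B1_def z_def using s bb(1) c[OF p] Lip[OF p] K \<epsilon> xy by (intro layer_bracket_le) auto
  with gb(1) have "\<bar>g x * B1\<bar> \<le> K * (4 * K ^ 3 * (1 + z))" by (rule abs_mult_le)
  hence N1: "\<bar>g x * B1\<bar> \<le> K ^ 4 * (4 + 4 * z)" by (simp add: eval_nat_numeral algebra_simps)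
  have "\<bar>g1 x * \<beta>1 x * z\<bar> \<le> K * K * z" "\<bar>g x * \<beta>1 x * z\<bar> \<le> K * K * z" "\<bar>g x * \<beta>2 x * z\<bar> \<le> K * K * z"
    "\<bar>g x * ((\<beta>1 x * z) * (\<beta>1 x * z))\<bar> \<le> K * ((K * z) * (K * z))"
    by (intro abs_mult_le gb bb zz)+
  hence e: "\<bar>g1 x * \<beta>1 x * z\<bar> \<le> K\<^sup>2 * z" "\<bar>g x * \<beta>1 x * z\<bar> \<le> K\<^sup>2 * z" "\<bar>g x * \<beta>2 x * z\<bar> \<le> K\<^sup>2 * z"
    "\<bar>g x * (\<beta>1 x * z)\<^sup>2\<bar> \<le> K ^ 3 * z\<^sup>2"
    by (simp_all add: power2_eq_square power3_eq_cube mult_ac)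
  have K2z: "K\<^sup>2 * z \<le> K ^ 3 * z" using pw[of 2 3] z by (auto intro: mult_right_mono)
  have "\<bar>B2\<bar> \<le> K + 3 * (K\<^sup>2 * z) + K ^ 3 * z\<^sup>2"
    unfolding B2_def using e gb(3) by (simp only: mult.assoc)
  hence "\<bar>B2\<bar> \<le> K ^ 3 * (1 + 3 * z + z\<^sup>2)"
    using K2z pw[of 1 3] by (simp add: distrib_left)
  with s(1) have "\<bar>\<sigma> y * B2\<bar> \<le> K * (K ^ 3 * (1 + 3 * z + z\<^sup>2))" by (rule abs_mult_le)
  from abs_mult_le[of \<epsilon> 1, OF _ this] \<epsilon>
  have "\<bar>\<epsilon> * (\<sigma> y * B2)\<bar> \<le> 1 * (K * (K ^ 3 * (1 + 3 * z + z\<^sup>2)))" by simp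
  hence N2: "\<bar>\<epsilon> * (\<sigma> y * B2)\<bar> \<le> K ^ 4 * (1 + 3 * z + z\<^sup>2)" by (simp add: eval_nat_numeral algebra_simps)
  have "\<bar>B3\<bar> \<le> K\<^sup>2 * (1 + z)"
    unfolding B3_def using e gb(2) pw[of 1 2] by (simp add: distrib_left)
  with a[OF p] s(1) have "\<bar>a p * \<sigma> y * B3\<bar> \<le> K * K * (K\<^sup>2 * (1 + z))" by (intro abs_mult_le)
  hence N3: "\<bar>a p * \<sigma> y * B3\<bar> \<le> K ^ 4 * (1 + z)" by (simp add: eval_nat_numeral algebra_simps)
  have "\<bar>N\<bar> \<le> K ^ 4 * (4 + 4 * z) + K ^ 4 * (1 + 3 * z + z\<^sup>2) + K ^ 4 * (1 + z)"
    unfolding N_def using N1 N2 N3 by linarith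
  also have "\<dots> = K ^ 4 * (6 + 8 * z + z\<^sup>2)" by (simp add: algebra_simps)
  \<comment> \<open>The constant 8 is the largest coefficient of 6 + 8 z + z^2.\<close>
  also have "\<dots> \<le> K ^ 4 * (8 * (1 + z + z\<^sup>2))" using K z by (intro mult_left_mono) auto
  finally have "\<bar>N\<bar> * E \<le> K ^ 4 * (8 * (1 + z + z\<^sup>2)) * E" by (rule mult_right_mono) (simp add: E_def)
  also have "\<dots> = 8 * K ^ 4 * ((1 + z + z\<^sup>2) * exp (- \<beta> x * z))" by (simp add: E_def)
  also have "\<dots> \<le> 8 * K ^ 4 * ((1 + 1 / \<gamma> + 2 / \<gamma>\<^sup>2) * exp (- \<gamma> * z))"
    using K z \<gamma> xy by (intro mult_left_mono quadratic_exp_le) auto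
  finally have main: "\<bar>N * E\<bar> \<le> 8 * K ^ 4 * (1 + 1 / \<gamma> + 2 / \<gamma>\<^sup>2) * exp (- \<gamma> * z)"
    by (simp add: abs_mult E_def)
  have B1': "B1 = \<epsilon> * (\<sigma>2 y - 2 * \<sigma>1 y * (\<beta> x / \<epsilon>) + \<sigma> y * (\<beta> x / \<epsilon>)\<^sup>2) + c p * (\<sigma>1 y - \<sigma> y * (\<beta> x / \<epsilon>))"
    unfolding B1_def using \<epsilon> by (simp add: field_simps power2_eq_square)
  have "- \<epsilon> * (- \<sigma> y * B2 * E + - g x * (\<sigma>2 y - 2 * \<sigma>1 y * (\<beta> x / \<epsilon>) + \<sigma> y * (\<beta> x / \<epsilon>)\<^sup>2) * E)
      - a p * (- \<sigma> y * B3 * E) - c p * (- g x * (\<sigma>1 y - \<sigma> y * (\<beta> x / \<epsilon>)) * E) = N * E"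
    unfolding N_def B1' by (simp add: algebra_simps)
  moreover have "exp (- \<beta> x * y / \<epsilon>) = E" "exp (- \<gamma> * y / \<epsilon>) = exp (- \<gamma> * z)"
    by (simp_all add: E_def z_def)
  ultimately show "\<bar>- \<epsilon> * (- \<sigma> (snd p) * (g2 (fst p) - 2 * g1 (fst p) * \<beta>1 (fst p) * (snd p / \<epsilon>)
        - g (fst p) * \<beta>2 (fst p) * (snd p / \<epsilon>) + g (fst p) * (\<beta>1 (fst p) * (snd p / \<epsilon>))\<^sup>2)
          * exp (- \<beta> (fst p) * snd p / \<epsilon>)
      + - g (fst p) * (\<sigma>2 (snd p) - 2 * \<sigma>1 (snd p) * (\<beta> (fst p) / \<epsilon>) + \<sigma> (snd p) * (\<beta> (fst p) / \<epsilon>)\<^sup>2)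
          * exp (- \<beta> (fst p) * snd p / \<epsilon>))
      - a p * (- \<sigma> (snd p) * (g1 (fst p) - g (fst p) * \<beta>1 (fst p) * (snd p / \<epsilon>)) * exp (- \<beta> (fst p) * snd p / \<epsilon>))
      - c p * (- g (fst p) * (\<sigma>1 (snd p) - \<sigma> (snd p) * (\<beta> (fst p) / \<epsilon>)) * exp (- \<beta> (fst p) * snd p / \<epsilon>))\<bar>
    \<le> 8 * K ^ 4 * (1 + 1 / \<gamma> + 2 / \<gamma>\<^sup>2) * exp (- \<gamma> * snd p / \<epsilon>)"
    using main by (simp add: xy(1) B2_def B3_def z_def)
qed

text \<open>Both coefficients are frozen at the origin, so the freezing error is of order x + y, and
  the exponentials in both variables are used to absorb (x + y) / \<epsilon>.\<close>

lemma corner_layer_residual_le: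
  fixes \<epsilon> K \<gamma> \<alpha> \<beta> m :: real
  assumes \<sigma>: "C2_bounded K \<sigma> \<sigma>1 \<sigma>2" and \<tau>: "C2_bounded K \<tau> \<tau>1 \<tau>2"
    and K: "K \<ge> 1" and \<epsilon>: "0 < \<epsilon>" "\<epsilon> \<le> 1"
    and \<gamma>: "\<gamma> > 0" "\<alpha> \<ge> 2 * \<gamma>" "\<beta> \<ge> 2 * \<gamma>"
    and bd: "\<bar>\<alpha>\<bar> \<le> K" "\<bar>\<beta>\<bar> \<le> K" "\<bar>m\<bar> \<le> K"
    and a: "\<And>p. p \<in> Omega \<Longrightarrow> \<bar>a p\<bar> \<le> K" and c: "\<And>p. p \<in> Omega \<Longrightarrow> \<bar>c p\<bar> \<le> K"
    and Lip: "\<And>p. p \<in> Omega \<Longrightarrow> \<bar>\<alpha> - a p\<bar> \<le> K * (fst p + snd p)"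
      "\<And>p. p \<in> Omega \<Longrightarrow> \<bar>\<beta> - c p\<bar> \<le> K * (fst p + snd p)"
  obtains Tx Ty Txx Tyy where
    "C2_partials (\<lambda>p. \<sigma> (fst p) * \<tau> (snd p) * m * exp (- \<alpha> * fst p / \<epsilon>) * exp (- \<beta> * snd p / \<epsilon>)) Tx Ty Txx Tyy"
    "\<And>p. p \<in> Omega \<Longrightarrow> \<bar>- \<epsilon> * (Txx p + Tyy p) - a p * Tx p - c p * Ty p\<bar>
       \<le> 8 * K ^ 5 * (1 + 1 / \<gamma> + 2 / \<gamma>\<^sup>2)\<^sup>2 * exp (- \<gamma> * snd p / \<epsilon>)"
proof -
  define e where "e p = exp (- \<alpha> * fst p / \<epsilon>) * exp (- \<beta> * snd p / \<epsilon>)" for p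
  define Tx where "Tx p = m * \<tau> (snd p) * (\<sigma>1 (fst p) - \<sigma> (fst p) * (\<alpha> / \<epsilon>)) * e p" for p
  define Ty where "Ty p = m * \<sigma> (fst p) * (\<tau>1 (snd p) - \<tau> (snd p) * (\<beta> / \<epsilon>)) * e p" for p
  define Txx where "Txx p = m * \<tau> (snd p) * (\<sigma>2 (fst p) - 2 * \<sigma>1 (fst p) * (\<alpha> / \<epsilon>) + \<sigma> (fst p) * (\<alpha> / \<epsilon>)\<^sup>2) * e p" for p
  define Tyy where "Tyy p = m * \<sigma> (fst p) * (\<tau>2 (snd p) - 2 * \<tau>1 (snd p) * (\<beta> / \<epsilon>) + \<tau> (snd p) * (\<beta> / \<epsilon>)\<^sup>2) * e p" for p
  note cont = C2_bounded_continuous[OF \<sigma>] C2_bounded_continuous[OF \<tau>]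
  have ce: "continuous_on Omega e"
    unfolding e_def using \<epsilon> by (auto intro!: continuous_intros)
  have De: "((\<lambda>s. e (s, y)) has_real_derivative - (\<alpha> / \<epsilon>) * e (x, y)) (at x)"
    "((\<lambda>t. e (x, t)) has_real_derivative - (\<beta> / \<epsilon>) * e (x, y)) (at y)" for x y
    unfolding e_def using \<epsilon> by (auto intro!: derivative_eq_intros)
  have D: "(\<sigma> has_real_derivative \<sigma>1 x) (at x)" "(\<sigma>1 has_real_derivative \<sigma>2 x) (at x)"
    "(\<tau> has_real_derivative \<tau>1 y) (at y)" "(\<tau>1 has_real_derivative \<tau>2 y) (at y)"
    if "(x, y) \<in> Omega" for x y
    using \<sigma> \<tau> that by (auto simp: C2_bounded_def)
  have "C2_partials (\<lambda>p. \<sigma> (fst p) * \<tau> (snd p) * m * e p) Tx Ty Txx Tyy"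
    unfolding C2_partials_def
  proof (intro conjI allI impI)
    fix x y assume xy: "(x, y) \<in> Omega"
    note [derivative_intros] = De D[OF xy]
    show "((\<lambda>s. \<sigma> (fst (s, y)) * \<tau> (snd (s, y)) * m * e (s, y)) has_real_derivative Tx (x, y)) (at x)"
      unfolding Tx_def using \<epsilon> by (auto intro!: derivative_eq_intros simp: field_simps)
    show "((\<lambda>t. \<sigma> (fst (x, t)) * \<tau> (snd (x, t)) * m * e (x, t)) has_real_derivative Ty (x, y)) (at y)"
      unfolding Ty_def using \<epsilon> by (auto intro!: derivative_eq_intros simp: field_simps)
    show "((\<lambda>s. Tx (s, y)) has_real_derivative Txx (x, y)) (at x)"
      unfolding Tx_def Txx_def using \<epsilon> by (auto intro!: derivative_eq_intros simp: field_simps power2_eq_square)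
    show "((\<lambda>t. Ty (x, t)) has_real_derivative Tyy (x, y)) (at y)"
      unfolding Ty_def Tyy_def using \<epsilon> by (auto intro!: derivative_eq_intros simp: field_simps power2_eq_square)
  qed (use \<epsilon> in \<open>auto intro!: continuous_intros cont ce simp: Tx_def Ty_def Txx_def Tyy_def\<close>)
  hence C2: "C2_partials (\<lambda>p. \<sigma> (fst p) * \<tau> (snd p) * m * exp (- \<alpha> * fst p / \<epsilon>) * exp (- \<beta> * snd p / \<epsilon>)) Tx Ty Txx Tyy"
    by (simp add: e_def mult.assoc)
  show thesis
  proof (rule that[OF C2])
    fix p assume p: "p \<in> Omega"
    obtain x y where xy: "p = (x, y)" "x \<in> {0<..<1}" "y \<in> {0<..<1}" using p by (cases p) auto
    define B1 where "B1 = \<epsilon> * \<sigma>2 x + (a p - 2 * \<alpha>) * \<sigma>1 x + \<sigma> x * \<alpha> * (\<alpha> - a p) / \<epsilon>"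
    define B2 where "B2 = \<epsilon> * \<tau>2 y + (c p - 2 * \<beta>) * \<tau>1 y + \<tau> y * \<beta> * (\<beta> - c p) / \<epsilon>"
    have z: "x / \<epsilon> \<ge> 0" "y / \<epsilon> \<ge> 0" using xy \<epsilon> by auto
    define C where "C = 1 + 1 / \<gamma> + 2 / \<gamma>\<^sup>2"
    have C: "C \<ge> 0" using \<gamma> by (simp add: C_def)
    have s: "\<bar>\<sigma> x\<bar> \<le> K" "\<bar>\<sigma>1 x\<bar> \<le> K" "\<bar>\<sigma>2 x\<bar> \<le> K" using \<sigma> xy by (auto simp: C2_bounded_def)
    have t: "\<bar>\<tau> y\<bar> \<le> K" "\<bar>\<tau>1 y\<bar> \<le> K" "\<bar>\<tau>2 y\<bar> \<le> K" using \<tau> xy by (auto simp: C2_bounded_def)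
    have "\<bar>B1\<bar> \<le> 4 * K ^ 3 * (1 + (x + y) / \<epsilon>)"
      unfolding B1_def by (rule layer_bracket_le[OF s bd(1) a[OF p] _ K \<epsilon>]) (use Lip(1)[OF p] xy in simp)
    hence 1: "\<bar>m * \<tau> y * B1\<bar> \<le> K * K * (4 * K ^ 3 * (1 + (x + y) / \<epsilon>))"
      using bd t by (intro abs_mult_le)
    have "\<bar>B2\<bar> \<le> 4 * K ^ 3 * (1 + (x + y) / \<epsilon>)"
      unfolding B2_def by (rule layer_bracket_le[OF t bd(2) c[OF p] _ K \<epsilon>]) (use Lip(2)[OF p] xy in simp)
    hence 2: "\<bar>m * \<sigma> x * B2\<bar> \<le> K * K * (4 * K ^ 3 * (1 + (x + y) / \<epsilon>))"
      using bd s by (intro abs_mult_le)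
    have "\<bar>m * \<tau> y * B1 + m * \<sigma> x * B2\<bar> \<le> 2 * (K * K * (4 * K ^ 3 * (1 + (x + y) / \<epsilon>)))"
      using 1 2 by linarith
    also have "\<dots> = 8 * K ^ 5 * (1 + x / \<epsilon> + y / \<epsilon>)" by (simp add: eval_nat_numeral add_divide_distrib)
    \<comment> \<open>Passing from the sum to a product lets each factor be absorbed by the
      exponential in its own variable.\<close>
    also have "\<dots> \<le> 8 * K ^ 5 * ((1 + x / \<epsilon> + (x / \<epsilon>)\<^sup>2) * (1 + y / \<epsilon> + (y / \<epsilon>)\<^sup>2))"
    proof (intro mult_left_mono)
      have "1 + X + Y \<le> (1 + X + X\<^sup>2) * (1 + Y + Y\<^sup>2)" if "X \<ge> 0" "Y \<ge> 0" for X Y :: real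
      proof -
        have "1 + X + Y \<le> (1 + X) * (1 + Y)" using that by (simp add: algebra_simps)
        also have "\<dots> \<le> (1 + X + X\<^sup>2) * (1 + Y + Y\<^sup>2)" using that by (intro mult_mono) auto
        finally show ?thesis .
      qed
      thus "1 + x / \<epsilon> + y / \<epsilon> \<le> (1 + x / \<epsilon> + (x / \<epsilon>)\<^sup>2) * (1 + y / \<epsilon> + (y / \<epsilon>)\<^sup>2)" using z by blast
    qed (use K in auto)
    finally have "\<bar>m * \<tau> y * B1 + m * \<sigma> x * B2\<bar> * e p
        \<le> 8 * K ^ 5 * ((1 + x / \<epsilon> + (x / \<epsilon>)\<^sup>2) * (1 + y / \<epsilon> + (y / \<epsilon>)\<^sup>2)) * e p"
      by (rule mult_right_mono) (simp add: e_def)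
    also have "\<dots> = 8 * K ^ 5 * (((1 + x / \<epsilon> + (x / \<epsilon>)\<^sup>2) * exp (- \<alpha> * (x / \<epsilon>)))
        * ((1 + y / \<epsilon> + (y / \<epsilon>)\<^sup>2) * exp (- \<beta> * (y / \<epsilon>))))"
      by (simp add: e_def xy)
    also have "\<dots> \<le> 8 * K ^ 5 * ((C * exp (- \<gamma> * (x / \<epsilon>))) * (C * exp (- \<gamma> * (y / \<epsilon>))))"
      unfolding C_def using z \<gamma> K by (intro mult_left_mono mult_mono quadratic_exp_le) auto
    \<comment> \<open>The remaining decay in x is discarded, because the barrier handles sums of
      one-variable exponentials.\<close>
    also have "\<dots> \<le> 8 * K ^ 5 * ((C * 1) * (C * exp (- \<gamma> * (y / \<epsilon>))))"
    proof -
      have "exp (- \<gamma> * (x / \<epsilon>)) \<le> 1" using mult_nonneg_nonneg[of \<gamma> "x / \<epsilon>"] z \<gamma> by simp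
      thus ?thesis using C K by (intro mult_left_mono mult_right_mono) auto
    qed
    finally have main: "\<bar>(m * \<tau> y * B1 + m * \<sigma> x * B2) * e p\<bar> \<le> 8 * K ^ 5 * C\<^sup>2 * exp (- \<gamma> * y / \<epsilon>)"
      by (simp add: abs_mult e_def power2_eq_square mult.assoc)
    have B1': "B1 = \<epsilon> * (\<sigma>2 x - 2 * \<sigma>1 x * (\<alpha> / \<epsilon>) + \<sigma> x * (\<alpha> / \<epsilon>)\<^sup>2) + a p * (\<sigma>1 x - \<sigma> x * (\<alpha> / \<epsilon>))"
      unfolding B1_def using \<epsilon> by (simp add: field_simps power2_eq_square)
    have B2': "B2 = \<epsilon> * (\<tau>2 y - 2 * \<tau>1 y * (\<beta> / \<epsilon>) + \<tau> y * (\<beta> / \<epsilon>)\<^sup>2) + c p * (\<tau>1 y - \<tau> y * (\<beta> / \<epsilon>))"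
      unfolding B2_def using \<epsilon> by (simp add: field_simps power2_eq_square)
    have "- \<epsilon> * (Txx p + Tyy p) - a p * Tx p - c p * Ty p = - ((m * \<tau> y * B1 + m * \<sigma> x * B2) * e p)"
      unfolding Txx_def Tyy_def Tx_def Ty_def B1' B2' xy(1) fst_conv snd_conv by algebra
    thus "\<bar>- \<epsilon> * (Txx p + Tyy p) - a p * Tx p - c p * Ty p\<bar>
       \<le> 8 * K ^ 5 * (1 + 1 / \<gamma> + 2 / \<gamma>\<^sup>2)\<^sup>2 * exp (- \<gamma> * snd p / \<epsilon>)"
      using main by (simp add: xy(1) C_def)
  qed
qed

section \<open>Barrier and pointwise bound\<close>

text \<open>B is chosen so that B \<gamma>^2 = C + \<gamma>^2 beats the factor C of the exponentials
  with a margin. In A c0 = C + 4 B \<gamma> / r + 1 the first term beats C \<epsilon>, the second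
  repays the loss away from the two edges, and the last gives strictness.\<close>

lemma barrier_estimate:
  fixes \<epsilon> \<gamma> r c0 C :: real
  assumes w: "C2_partials w wx wy wxx wyy" "continuous_on (closure Omega) w"
      "\<And>p. p \<in> frontier Omega \<Longrightarrow> w p = 0"
    and pos: "\<epsilon> > 0" "\<gamma> > 0" "r > 0" "c0 > 0" "C \<ge> 0"
    and b: "\<And>p. p \<in> Omega \<Longrightarrow> b1 p \<ge> 0" "\<And>p. p \<in> Omega \<Longrightarrow> b2 p \<ge> 0"
      "\<And>p. p \<in> Omega \<Longrightarrow> b1 p + b2 p \<ge> c0"
      "\<And>p. p \<in> Omega \<Longrightarrow> fst p \<le> r \<Longrightarrow> b1 p \<ge> 2 * \<gamma>"
      "\<And>p. p \<in> Omega \<Longrightarrow> snd p \<le> r \<Longrightarrow> b2 p \<ge> 2 * \<gamma>"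
    and L: "\<And>p. p \<in> Omega \<Longrightarrow> \<bar>- \<epsilon> * (wxx p + wyy p) - b1 p * wx p - b2 p * wy p\<bar>
        \<le> C * (\<epsilon> + exp (- \<gamma> * fst p / \<epsilon>) + exp (- \<gamma> * snd p / \<epsilon>))"
    and p: "p \<in> closure Omega"
  defines "B \<equiv> C / \<gamma>\<^sup>2 + 1"
  shows "\<bar>w p\<bar> \<le> \<epsilon> * (2 * ((C + 4 * B * \<gamma> / r + 1) / c0) + 2 * B)"
proof -
  define A where "A = (C + 4 * B * \<gamma> / r + 1) / c0"
  define ex where "ex p = exp (- \<gamma> * fst p / \<epsilon>)" for p :: "real \<times> real"
  define ey where "ey p = exp (- \<gamma> * snd p / \<epsilon>)" for p :: "real \<times> real"
  define z where "z p = \<epsilon> * (A * (2 - fst p - snd p) + B * ex p + B * ey p)" for p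
  have B: "B > 0" using pos by (auto simp: B_def intro!: add_nonneg_pos)
  have A: "A \<ge> 0" using pos B by (auto simp: A_def)
  have zc: "continuous_on S z" for S
    unfolding z_def ex_def ey_def using pos by (auto intro!: continuous_intros)
  have C2: "C2_partials z (\<lambda>p. - \<epsilon> * A - B * \<gamma> * ex p) (\<lambda>p. - \<epsilon> * A - B * \<gamma> * ey p)
      (\<lambda>p. B * \<gamma>\<^sup>2 / \<epsilon> * ex p) (\<lambda>p. B * \<gamma>\<^sup>2 / \<epsilon> * ey p)"
    unfolding C2_partials_def
  proof (intro conjI allI impI)
    fix x y
    show "((\<lambda>s. z (s, y)) has_real_derivative - \<epsilon> * A - B * \<gamma> * ex (x, y)) (at x)"
      "((\<lambda>t. z (x, t)) has_real_derivative - \<epsilon> * A - B * \<gamma> * ey (x, y)) (at y)"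
      "((\<lambda>s. - \<epsilon> * A - B * \<gamma> * ex (s, y)) has_real_derivative B * \<gamma>\<^sup>2 / \<epsilon> * ex (x, y)) (at x)"
      "((\<lambda>t. - \<epsilon> * A - B * \<gamma> * ey (x, t)) has_real_derivative B * \<gamma>\<^sup>2 / \<epsilon> * ey (x, y)) (at y)"
      unfolding z_def ex_def ey_def using pos
      by (auto intro!: derivative_eq_intros simp: field_simps power2_eq_square)
  qed (use pos in \<open>auto intro!: continuous_intros zc simp: ex_def ey_def\<close>)
  have exy: "ex p > 0" "ey p > 0" for p by (simp_all add: ex_def ey_def)
  have z0: "z p \<ge> 0" if "p \<in> closure Omega" for p
    using that A B pos exy[of p] by (cases p) (auto simp: z_def intro!: add_nonneg_nonneg mult_nonneg_nonneg)
  \<comment> \<open>For t \<le> r the factor \<beta> - \<gamma> is at least \<gamma>. For t > r it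
    may be as low as - \<gamma>, but there \<gamma> exp (- \<gamma> t / \<epsilon>) \<le> \<epsilon>
    / r, and twice this is the error allowed.\<close>
  have layer: "(\<beta> - \<gamma>) * exp (- \<gamma> * t / \<epsilon>) \<ge> \<gamma> * exp (- \<gamma> * t / \<epsilon>) - 2 * \<epsilon> / r"
    if "\<beta> \<ge> 0" "t \<le> r \<Longrightarrow> \<beta> \<ge> 2 * \<gamma>" "t > 0" for \<beta> t
  proof (cases "t \<le> r")
    case True
    hence "\<gamma> * exp (- \<gamma> * t / \<epsilon>) \<le> (\<beta> - \<gamma>) * exp (- \<gamma> * t / \<epsilon>)"
      using that by (intro mult_right_mono) auto
    moreover have "0 \<le> 2 * \<epsilon> / r" using pos by simp
    ultimately show ?thesis by linarith
  next
    case False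
    have "\<gamma> * r / \<epsilon> \<le> \<gamma> * t / \<epsilon>" using False pos by (simp add: divide_right_mono)
    also have "\<dots> \<le> exp (\<gamma> * t / \<epsilon>)" using exp_ge_add_one_self[of "\<gamma> * t / \<epsilon>"] by linarith
    finally have "\<gamma> * r / \<epsilon> * exp (- \<gamma> * t / \<epsilon>) \<le> exp (\<gamma> * t / \<epsilon>) * exp (- \<gamma> * t / \<epsilon>)"
      by (rule mult_right_mono) simp
    also have "\<dots> = 1" by (simp add: exp_add[symmetric])
    finally have "\<gamma> * exp (- \<gamma> * t / \<epsilon>) \<le> \<epsilon> / r" using pos by (simp add: field_simps)
    moreover have "0 \<le> \<beta> * exp (- \<gamma> * t / \<epsilon>)" using that by simp
    moreover have "2 * \<epsilon> / r = 2 * (\<epsilon> / r)" by simp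
    ultimately show ?thesis unfolding left_diff_distrib by linarith
  qed
  have "\<bar>w p\<bar> \<le> z p"
  proof (rule comparison[OF w C2 zc _ pos(1) _ p, where ?b1.0 = b1 and ?b2.0 = b2])
    show "z q \<ge> 0" if "q \<in> frontier Omega" for q using z0 that by (simp add: frontier_Omega)
    fix q assume q: "q \<in> Omega"
    hence q': "fst q > 0" "snd q > 0" by (cases q; simp)+
    have *: "(b1 q - \<gamma>) * ex q \<ge> \<gamma> * ex q - 2 * \<epsilon> / r" "(b2 q - \<gamma>) * ey q \<ge> \<gamma> * ey q - 2 * \<epsilon> / r"
      unfolding ex_def ey_def using layer b q q' by blast+
    hence "(b1 q - \<gamma>) * ex q + (b2 q - \<gamma>) * ey q \<ge> \<gamma> * (ex q + ey q) - 4 * \<epsilon> / r"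
    proof -
      have "4 * \<epsilon> / r = 2 * \<epsilon> / r + 2 * \<epsilon> / r" by simp
      thus ?thesis using * unfolding distrib_left by linarith
    qed
    hence "B * \<gamma> * ((b1 q - \<gamma>) * ex q + (b2 q - \<gamma>) * ey q) \<ge> B * \<gamma> * (\<gamma> * (ex q + ey q) - 4 * \<epsilon> / r)"
      using B pos by (intro mult_left_mono) auto
    moreover have "\<epsilon> * A * (b1 q + b2 q) \<ge> \<epsilon> * A * c0" using b(3)[OF q] A pos by (intro mult_left_mono) auto
    moreover have "\<epsilon> * A * c0 = \<epsilon> * (C + 4 * B * \<gamma> / r + 1)" using pos by (simp add: A_def)
    moreover have "B * \<gamma> * (\<gamma> * (ex q + ey q) - 4 * \<epsilon> / r)
        = (C + \<gamma>\<^sup>2) * (ex q + ey q) - \<epsilon> * (4 * B * \<gamma> / r)"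
    proof -
      have "B * \<gamma>\<^sup>2 = C + \<gamma>\<^sup>2" using pos by (simp add: B_def field_simps)
      hence "C + \<gamma>\<^sup>2 = B * \<gamma> * \<gamma>" by (simp add: power2_eq_square)
      thus ?thesis by (simp add: algebra_simps)
    qed
    moreover have "\<epsilon> > 0" "\<gamma>\<^sup>2 * (ex q + ey q) > 0" using pos exy[of q] by (auto intro!: mult_pos_pos add_pos_pos)
    ultimately have "\<epsilon> * A * (b1 q + b2 q) + B * \<gamma> * ((b1 q - \<gamma>) * ex q + (b2 q - \<gamma>) * ey q)
        > C * (\<epsilon> + ex q + ey q)"
      by (simp add: algebra_simps)
    also have "\<epsilon> * A * (b1 q + b2 q) + B * \<gamma> * ((b1 q - \<gamma>) * ex q + (b2 q - \<gamma>) * ey q)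
      = - \<epsilon> * (B * \<gamma>\<^sup>2 / \<epsilon> * ex q + B * \<gamma>\<^sup>2 / \<epsilon> * ey q) - b1 q * (- \<epsilon> * A - B * \<gamma> * ex q)
        - b2 q * (- \<epsilon> * A - B * \<gamma> * ey q)"
      using pos by (simp add: field_simps power2_eq_square)
    finally show "\<bar>- \<epsilon> * (wxx q + wyy q) - b1 q * wx q - b2 q * wy q\<bar> < \<dots>"
      using L[OF q] by (simp add: ex_def ey_def)
  qed
  also have "z p \<le> \<epsilon> * (A * 2 + B * 1 + B * 1)"
    unfolding z_def using p A B pos
    by (intro mult_left_mono add_mono) (cases p; auto simp: ex_def ey_def)+
  finally show ?thesis unfolding A_def[symmetric] by (simp add: algebra_simps)
qed

section \<open>Integration over the open square\<close>

text \<open>The weight is of order one in the layers, but their width is of order \<epsilon>: each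
  exponential integrates to at most \<epsilon> / \<gamma>. The computation takes place on the full
  unit square, and nonnegativity allows the restriction to \<open>square a\<close>.\<close>

lemma integral_layer_weight_le:
  fixes \<epsilon> \<gamma> a :: real
  assumes "\<epsilon> > 0" "\<gamma> > 0" "0 < a" "a < 1/2"
  shows "integral (square a) (\<lambda>p. \<epsilon> + exp (- \<gamma> * fst p / \<epsilon>) + exp (- \<gamma> * snd p / \<epsilon>)) \<le> \<epsilon> * (1 + 2 / \<gamma>)"
proof -
  define e where "e t = exp (- \<gamma> * t / \<epsilon>)" for t
  define I where "I = integral {0..1} e"
  have ec: "continuous_on S (\<lambda>x. e (h x))" if "continuous_on S h" for S and h :: "'a::topological_space \<Rightarrow> real"
    unfolding e_def using assms that by (auto intro!: continuous_intros)
  have I: "I \<le> \<epsilon> / \<gamma>"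
  proof -
    have "(e has_integral (- (\<epsilon> / \<gamma>) * e 1 - (- (\<epsilon> / \<gamma>) * e 0))) {0..1}"
    proof (rule fundamental_theorem_of_calculus)
      fix t :: real
      have "((\<lambda>t. - (\<epsilon> / \<gamma>) * e t) has_real_derivative e t) (at t within {0..1})"
        unfolding e_def using assms by (auto intro!: derivative_eq_intros)
      thus "((\<lambda>t. - (\<epsilon> / \<gamma>) * e t) has_vector_derivative e t) (at t within {0..1})"
        by (simp add: has_real_derivative_iff_has_vector_derivative)
    qed simp
    hence "I = \<epsilon> / \<gamma> - (\<epsilon> / \<gamma>) * e 1" by (simp add: I_def integral_unique e_def)
    moreover have "0 \<le> (\<epsilon> / \<gamma>) * e 1" using assms by (simp add: e_def)
    ultimately show ?thesis by linarith
  qed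
  let ?Q = "cbox (0, 0) (1, 1) :: (real \<times> real) set"
  have c: "continuous_on S (\<lambda>p. \<epsilon>)" "continuous_on S (\<lambda>p. e (fst p))" "continuous_on S (\<lambda>p. e (snd p))"
    for S :: "(real \<times> real) set" by (intro continuous_intros ec)+
  have "integral ?Q (\<lambda>p. e (fst p)) = I"
    using integral_prod_continuous[OF c(2), of 0 0 1 1] by (simp add: I_def)
  moreover have "integral ?Q (\<lambda>p. e (snd p)) = I"
    using integral_prod_continuous[OF c(3), of 0 0 1 1] by (simp add: I_def)
  moreover have "integral ?Q (\<lambda>p. \<epsilon>) = \<epsilon>"
    using integral_prod_continuous[OF c(1), of 0 0 1 1] by simp
  ultimately have "integral ?Q (\<lambda>p. \<epsilon> + e (fst p) + e (snd p)) = \<epsilon> + I + I"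
    using c by (simp add: integral_add integrable_continuous continuous_on_add)
  moreover have "integral (square a) (\<lambda>p. \<epsilon> + e (fst p) + e (snd p)) \<le> integral ?Q (\<lambda>p. \<epsilon> + e (fst p) + e (snd p))"
    using c assms by (intro integral_subset_le integrable_continuous continuous_on_add)
      (auto simp: cbox_Pair_eq e_def)
  moreover have "\<epsilon> * (1 + 2 / \<gamma>) = \<epsilon> + \<epsilon> / \<gamma> + \<epsilon> / \<gamma>" by (simp add: algebra_simps)
  ultimately show ?thesis using I by (simp add: e_def)
qed

text \<open>Integrability on the open square is part of the claim, as the gradient of the remainder
  may be unbounded near the boundary. A bound on compact squares that is uniform in a gives it by
  monotone convergence.\<close>

lemma set_integrable_Omega_exhaustion:
  fixes f :: "real \<times> real \<Rightarrow> real"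
  assumes f: "continuous_on Omega f" "\<And>p. p \<in> Omega \<Longrightarrow> 0 \<le> f p"
    and B: "\<And>a. 0 < a \<Longrightarrow> a < 1/2 \<Longrightarrow> integral (square a) f \<le> B"
  shows "set_integrable lborel Omega f" "(LINT p:Omega|lborel. f p) \<le> B"
proof -
  \<comment> \<open>The shift by 3 keeps the inset below 1/2 already for n = 0.\<close>
  define S where "S n = square (1 / (real n + 3))" for n :: nat
  define h where "h p = indicator Omega p * f p" for p
  have S: "S n \<subseteq> Omega" "integral (S n) f \<le> B" for n
    unfolding S_def by (rule square_subset_Omega B; simp add: field_simps)+
  have inc: "incseq S"
  proof (rule incseq_SucI)
    fix n
    have "1 / (real (Suc n) + 3) \<le> 1 / (real n + 3)" by (intro divide_left_mono) auto
    thus "S n \<subseteq> S (Suc n)" unfolding S_def by (auto simp: cbox_Pair_eq)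
  qed
  have UnS: "(\<Union>n. S n) = Omega"
  proof (intro equalityI subsetI)
    fix p assume p: "p \<in> Omega"
    obtain x y where xy: "p = (x, y)" by fastforce
    define d where "d = min (min x (1 - x)) (min y (1 - y))"
    have "d > 0" using p xy by (simp add: d_def)
    then obtain n where n: "inverse (of_nat (Suc n)) < d" using reals_Archimedean by blast
    have "1 / (real n + 3) \<le> inverse (of_nat (Suc n))" by (simp add: field_simps)
    hence "1 / (real n + 3) \<le> d" using n by linarith
    hence "p \<in> S n" by (simp add: S_def xy d_def)
    thus "p \<in> (\<Union>n. S n)" by blast
  qed (use S in blast)
  have hm: "h \<in> borel_measurable borel"
    unfolding h_def using borel_measurable_continuous_on_indicator[OF _ f(1)] by (simp add: borel_open)
  have h0: "0 \<le> h p" for p using f(2) by (simp add: h_def indicator_def)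
  have fS: "set_integrable lborel (S n) f" for n
    unfolding S_def set_integrable_def
    by (rule borel_integrable_compact)
      (use S in \<open>auto simp: S_def intro: continuous_on_subset[OF f(1)]\<close>)
  have nS: "(\<integral>\<^sup>+p. ennreal (h p) * indicator (S n) p \<partial>lborel) \<le> ennreal B" for n
  proof -
    have "(\<integral>\<^sup>+p. ennreal (h p) * indicator (S n) p \<partial>lborel) = (\<integral>\<^sup>+p. ennreal (indicator (S n) p *\<^sub>R f p) \<partial>lborel)"
      by (rule nn_integral_cong) (use S in \<open>auto simp: h_def indicator_def\<close>)
    also have "\<dots> = ennreal (LINT p:S n|lborel. f p)"
      unfolding set_lebesgue_integral_def
    proof (rule nn_integral_eq_integral)
      have "0 \<le> indicator (S n) p *\<^sub>R f p" for p
        using S(1)[of n] f(2)[of p] by (auto simp: indicator_def)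
      thus "AE p in lborel. 0 \<le> indicator (S n) p *\<^sub>R f p" by simp
    qed (use fS in \<open>simp add: set_integrable_def\<close>)
    also have "\<dots> \<le> ennreal B"
      using set_borel_integral_eq_integral(2)[OF fS] S by (simp add: ennreal_leI)
    finally show ?thesis .
  qed
  \<comment> \<open>Monotone convergence in the guise of continuity from below of the measure with
    density h.\<close>
  let ?N = "density lborel (\<lambda>p. ennreal (h p))"
  have Sm: "S n \<in> sets lborel" for n by (simp add: S_def)
  have hm': "(\<lambda>p. ennreal (h p)) \<in> borel_measurable lborel" using hm by simp
  have "(\<integral>\<^sup>+p. ennreal (h p) \<partial>lborel) = (\<integral>\<^sup>+p. ennreal (h p) * indicator Omega p \<partial>lborel)"
    by (rule nn_integral_cong) (simp add: h_def indicator_def)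
  also have "\<dots> = emeasure ?N (\<Union>n. S n)"
    unfolding UnS by (rule emeasure_density[symmetric]) (use hm' in \<open>auto intro: borel_open\<close>)
  also have "\<dots> = (SUP n. emeasure ?N (S n))"
    by (rule SUP_emeasure_incseq[symmetric]) (use Sm inc in auto)
  also have "\<dots> \<le> ennreal B"
    using nS Sm hm' by (intro SUP_least) (simp add: emeasure_density)
  finally have nn: "(\<integral>\<^sup>+p. ennreal (h p) \<partial>lborel) \<le> ennreal B" .
  have int: "integrable lborel h"
    by (rule integrableI_nonneg) (use hm h0 nn in \<open>auto intro: le_less_trans\<close>)
  thus "set_integrable lborel Omega f" by (simp add: set_integrable_def h_def[abs_def])
  \<comment> \<open>Needed to return from \<open>ennreal\<close>, where a negative B would be read
    as 0.\<close>
  have "B \<ge> 0"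
  proof -
    have "0 \<le> integral (S 0) f"
      using set_borel_integral_eq_integral(1)[OF fS] S(1)[of 0] f(2) by (intro integral_nonneg) blast+
    thus ?thesis using S(2)[of 0] by linarith
  qed
  moreover have "ennreal (LINT p|lborel. h p) \<le> ennreal B"
    using nn_integral_eq_integral[OF int] h0 nn by simp
  ultimately have "(LINT p|lborel. h p) \<le> B" by (simp add: ennreal_le_iff)
  thus "(LINT p:Omega|lborel. f p) \<le> B" by (simp add: set_lebesgue_integral_def h_def[abs_def])
qed

lemma in_L2_exhaustion:
  fixes v :: "real \<times> real \<Rightarrow> 'a::euclidean_space"
  assumes v: "continuous_on Omega v"
    and B: "\<And>a. 0 < a \<Longrightarrow> a < 1/2 \<Longrightarrow> integral (square a) (\<lambda>p. (norm (v p))\<^sup>2) \<le> B"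
  shows "in_L2 v" "L2_norm v \<le> sqrt B"
proof -
  have "continuous_on Omega (\<lambda>p. (norm (v p))\<^sup>2)" using v by (intro continuous_intros)
  note * = set_integrable_Omega_exhaustion[OF this _ B]
  have "set_borel_measurable lborel Omega v"
    unfolding set_borel_measurable_def
    using borel_measurable_continuous_on_indicator[OF _ v] by (simp add: borel_open)
  thus "in_L2 v" unfolding in_L2_def using * by simp
  show "L2_norm v \<le> sqrt B" unfolding L2_norm_def using * by simp
qed

text \<open>The hypothesis compares the square of v with the weight, whose integral is of order
  \<epsilon>; a function of size one confined to the layers thus has norm of order sqrt
  \<epsilon>.\<close>

lemma in_L2_pointwise:
  fixes \<epsilon> \<gamma> C :: real and v :: "real \<times> real \<Rightarrow> real"
  assumes v: "continuous_on Omega v" and pos: "\<epsilon> > 0" "\<gamma> > 0"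
    and le: "\<And>p. p \<in> Omega \<Longrightarrow> (v p)\<^sup>2 \<le> C * (\<epsilon> + exp (- \<gamma> * fst p / \<epsilon>) + exp (- \<gamma> * snd p / \<epsilon>))"
    and C: "C \<ge> 0"
  shows "in_L2 v" "L2_norm v \<le> sqrt (C * (\<epsilon> * (1 + 2 / \<gamma>)))"
proof -
  have "integral (square a) (\<lambda>p. (norm (v p))\<^sup>2) \<le> C * (\<epsilon> * (1 + 2 / \<gamma>))" if a: "0 < a" "a < 1/2" for a
  proof -
    have sub: "square a \<subseteq> Omega" using a by (intro square_subset_Omega)
    have "integral (square a) (\<lambda>p. (norm (v p))\<^sup>2)
        \<le> integral (square a) (\<lambda>p. C * (\<epsilon> + exp (- \<gamma> * fst p / \<epsilon>) + exp (- \<gamma> * snd p / \<epsilon>)))"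
    proof (intro integral_le integrable_continuous)
      show "continuous_on (square a) (\<lambda>p. (norm (v p))\<^sup>2)"
        using continuous_on_subset[OF v sub] by (intro continuous_intros)
    qed (use sub le pos in \<open>auto intro!: continuous_intros\<close>)
    also have "\<dots> \<le> C * (\<epsilon> * (1 + 2 / \<gamma>))"
      using integral_layer_weight_le[OF pos a] C by (simp add: mult_left_mono)
    finally show ?thesis .
  qed
  from in_L2_exhaustion[OF v this]
  show "in_L2 v" "L2_norm v \<le> sqrt (C * (\<epsilon> * (1 + 2 / \<gamma>)))" by blast+
qed

section \<open>Gradient bound\<close>

definition bubble :: "real \<times> real \<Rightarrow> real" where
  "bubble p = fst p * (1 - fst p) * (snd p * (1 - snd p))"

lemma C2_partials_bubble:
  "C2_partials bubble (\<lambda>p. (1 - 2 * fst p) * (snd p * (1 - snd p))) (\<lambda>p. fst p * (1 - fst p) * (1 - 2 * snd p))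
    (\<lambda>p. - 2 * (snd p * (1 - snd p))) (\<lambda>p. - 2 * (fst p * (1 - fst p)))"
  unfolding C2_partials_def
proof (intro conjI allI impI)
  fix x y :: real
  show "((\<lambda>s. bubble (s, y)) has_real_derivative (1 - 2 * fst (x, y)) * (snd (x, y) * (1 - snd (x, y)))) (at x)"
    "((\<lambda>t. bubble (x, t)) has_real_derivative fst (x, y) * (1 - fst (x, y)) * (1 - 2 * snd (x, y))) (at y)"
    unfolding bubble_def fst_conv snd_conv
    by (rule derivative_eq_intros refl | simp add: algebra_simps)+
  show "((\<lambda>s. (1 - 2 * fst (s, y)) * (snd (s, y) * (1 - snd (s, y)))) has_real_derivative
      - 2 * (snd (x, y) * (1 - snd (x, y)))) (at x)"
    "((\<lambda>t. fst (x, t) * (1 - fst (x, t)) * (1 - 2 * snd (x, t))) has_real_derivative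
      - 2 * (fst (x, y) * (1 - fst (x, y)))) (at y)"
    unfolding fst_conv snd_conv
    by (rule derivative_eq_intros refl | simp add: algebra_simps)+
qed (auto intro!: continuous_intros simp: bubble_def[abs_def])

lemma unit_parabola_bounds:
  fixes x :: real
  assumes "0 < x" "x < 1"
  shows "0 \<le> x * (1 - x)" "x * (1 - x) \<le> 1" "\<bar>1 - 2 * x\<bar> \<le> 1"
proof -
  have "x * (1 - x) \<le> 1 * 1" using assms by (intro mult_mono) auto
  thus "x * (1 - x) \<le> 1" by simp
qed (use assms in auto)

text \<open>The truncated energy only sees the set where the function exceeds the truncation level, and it
  misses the zero set of \<open>w\<close> in the limit.  Adding and subtracting \<open>w\<close> from a small multiple of the
  positive function \<open>bubble\<close>, one of the two functions exceeds the level at every point of a given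
  compact square.\<close>

lemma gradient_estimate:
  fixes \<epsilon> \<gamma> C D K M a :: real
  assumes w: "C2_partials w wx wy wxx wyy" "continuous_on (closure Omega) w"
      "\<And>p. p \<in> frontier Omega \<Longrightarrow> w p = 0"
    and b: "continuous_on Omega b1" "continuous_on Omega b2" "continuous_on Omega b1x" "continuous_on Omega b2y"
      "\<And>x y. (x, y) \<in> Omega \<Longrightarrow> ((\<lambda>s. b1 (s, y)) has_real_derivative b1x (x, y)) (at x)"
      "\<And>x y. (x, y) \<in> Omega \<Longrightarrow> ((\<lambda>t. b2 (x, t)) has_real_derivative b2y (x, y)) (at y)"
      "\<And>p. p \<in> Omega \<Longrightarrow> \<bar>b1x p + b2y p\<bar> \<le> D"
      "\<And>p. p \<in> Omega \<Longrightarrow> \<bar>b1 p\<bar> \<le> K" "\<And>p. p \<in> Omega \<Longrightarrow> \<bar>b2 p\<bar> \<le> K"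
    and pos: "0 < \<epsilon>" "\<epsilon> \<le> 1" "\<gamma> > 0" "C \<ge> 0" "0 < a" "a < 1/2"
    and M: "\<And>p. p \<in> Omega \<Longrightarrow> \<bar>w p\<bar> \<le> M * \<epsilon>"
    and L: "\<And>p. p \<in> Omega \<Longrightarrow> \<bar>- \<epsilon> * (wxx p + wyy p) - b1 p * wx p - b2 p * wy p\<bar>
        \<le> C * (\<epsilon> + exp (- \<gamma> * fst p / \<epsilon>) + exp (- \<gamma> * snd p / \<epsilon>))"
  shows "integral (square a) (\<lambda>p. (wx p)\<^sup>2 + (wy p)\<^sup>2)
    \<le> \<epsilon> * (8 * ((M + 1) * ((C + 4 + 2 * K) * (1 + 2 / \<gamma>)) + D * (M + 1)\<^sup>2 / 2) + 4)"
proof -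
  define Q where "Q = (M + 1) * ((C + 4 + 2 * K) * (1 + 2 / \<gamma>)) + D * (M + 1)\<^sup>2 / 2"
  define \<rho> where "\<rho> p = \<epsilon> + exp (- \<gamma> * fst p / \<epsilon>) + exp (- \<gamma> * snd p / \<epsilon>)" for p
  define zx where "zx p = (1 - 2 * fst p) * (snd p * (1 - snd p))" for p :: "real \<times> real"
  define zy where "zy p = fst p * (1 - fst p) * (1 - 2 * snd p)" for p :: "real \<times> real"
  define zxx where "zxx p = - 2 * (snd p * (1 - snd p))" for p :: "real \<times> real"
  define zyy where "zyy p = - 2 * (fst p * (1 - fst p))" for p :: "real \<times> real"
  have z: "C2_partials bubble zx zy zxx zyy"
    using C2_partials_bubble unfolding zx_def zy_def zxx_def zyy_def .
  have zb: "0 \<le> bubble p" "bubble p \<le> 1" "\<bar>zx p\<bar> \<le> 1" "\<bar>zy p\<bar> \<le> 1" "\<bar>zxx p\<bar> \<le> 2" "\<bar>zyy p\<bar> \<le> 2"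
    if p: "p \<in> Omega" for p
  proof -
    obtain x y where xy: "p = (x, y)" "0 < x" "x < 1" "0 < y" "y < 1" using p by (cases p) auto
    note u = unit_parabola_bounds[OF xy(2,3)] unit_parabola_bounds[OF xy(4,5)]
    show "0 \<le> bubble p" "\<bar>zxx p\<bar> \<le> 2" "\<bar>zyy p\<bar> \<le> 2" using u by (simp_all add: bubble_def zxx_def zyy_def xy)
    have "bubble p \<le> 1 * 1" unfolding bubble_def xy using u by (intro mult_mono) auto
    thus "bubble p \<le> 1" by simp
    have "\<bar>zx p\<bar> \<le> 1 * 1" "\<bar>zy p\<bar> \<le> 1 * 1"
      unfolding zx_def zy_def xy fst_conv snd_conv by (intro abs_mult_le; use u in simp)+
    thus "\<bar>zx p\<bar> \<le> 1" "\<bar>zy p\<bar> \<le> 1" by simp_all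
  qed
  have half: "(1/2, 1/2) \<in> Omega" by simp
  have K0: "K \<ge> 0" using b(8)[OF half] by simp
  have M0: "M \<ge> 0"
  proof -
    have "0 \<le> M * \<epsilon>" using M[OF half] by linarith
    thus ?thesis using pos by (simp add: zero_le_mult_iff)
  qed
  have D0: "D \<ge> 0" using b(7)[OF half] by simp
  have \<rho>: "\<epsilon> \<le> \<rho> p" "0 < \<rho> p" for p using pos by (simp_all add: \<rho>_def add_pos_pos)
  have \<rho>c: "continuous_on S \<rho>" for S
    unfolding \<rho>_def using pos by (auto intro!: continuous_intros)
  \<comment> \<open>On \<open>square a\<close> the bubble is at least a^4, hence \<epsilon>
    \<open>bubble\<close> \<ge> 2 \<delta>: after subtracting the level, at least \<delta> is left,
    where the second derivative of the truncation is at least 1/2. The resulting bound does not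
    involve \<delta>, and so is uniform in a.\<close>
  define \<delta> where "\<delta> = \<epsilon> * a ^ 4 / 2"
  have \<delta>: "\<delta> > 0" using pos by (simp add: \<delta>_def)
  define v where "v s p = \<epsilon> * bubble p + s * w p" for s p
  define E where "E s p = trunc_sq'' \<delta> (max 0 (v s p - \<delta>)) * ((\<epsilon> * zx p + s * wx p)\<^sup>2 + (\<epsilon> * zy p + s * wy p)\<^sup>2)" for s p
  have C2v: "C2_partials (v s) (\<lambda>p. \<epsilon> * zx p + s * wx p) (\<lambda>p. \<epsilon> * zy p + s * wy p)
      (\<lambda>p. \<epsilon> * zxx p + s * wxx p) (\<lambda>p. \<epsilon> * zyy p + s * wyy p)" for s
    unfolding v_def[abs_def] by (intro C2_partials_add C2_partials_cmult z w)
  have energy: "integral (square a) (E s) \<le> \<epsilon> * Q" if s: "s = 1 \<or> s = - 1" for s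
  proof -
    have "\<epsilon> * integral (square a) (E s) \<le> ((M + 1) * \<epsilon>) * ((C + 4 + 2 * K) * (\<epsilon> * (1 + 2 / \<gamma>))) + D * ((M + 1) * \<epsilon>)\<^sup>2 / 2"
      unfolding E_def[abs_def]
    proof (rule energy_estimate[OF C2v _ _ b(1-7), where r = "\<lambda>p. (C + 4 + 2 * K) * \<rho> p"])
      show "continuous_on (closure Omega) (v s)"
        unfolding v_def[abs_def] bubble_def using w by (intro continuous_intros)
      show "v s p = 0" if "p \<in> frontier Omega" for p
        using that w(3)[OF that] by (cases p) (auto simp: v_def bubble_def frontier_Omega)
      show "v s p \<le> (M + 1) * \<epsilon>" if "p \<in> Omega" for p
      proof -
        have "\<epsilon> * bubble p \<le> \<epsilon> * 1" using zb(2)[OF that] pos by (intro mult_left_mono) auto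
        moreover have "s * w p \<le> M * \<epsilon>" using M[OF that] s by auto
        ultimately show ?thesis by (simp add: v_def algebra_simps)
      qed
      show "\<bar>- \<epsilon> * (\<epsilon> * zxx p + s * wxx p + (\<epsilon> * zyy p + s * wyy p)) - b1 p * (\<epsilon> * zx p + s * wx p)
          - b2 p * (\<epsilon> * zy p + s * wy p)\<bar> \<le> (C + 4 + 2 * K) * \<rho> p" if p: "p \<in> Omega" for p
      proof -
        \<comment> \<open>The perturbation is \<epsilon> times the bubble, so its residual
          \<epsilon> Z is at most (4 + 2 K) \<epsilon>, which the weight \<rho> dominates.\<close>
        define Z where "Z = - \<epsilon> * (zxx p + zyy p) - b1 p * zx p - b2 p * zy p"
        define W where "W = - \<epsilon> * (wxx p + wyy p) - b1 p * wx p - b2 p * wy p"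
        have "\<bar>\<epsilon> * (zxx p + zyy p)\<bar> \<le> 1 * 4" "\<bar>b1 p * zx p\<bar> \<le> K * 1" "\<bar>b2 p * zy p\<bar> \<le> K * 1"
          by (intro abs_mult_le; use zb[OF p] b(8,9)[OF p] pos in linarith)+
        hence "\<bar>Z\<bar> \<le> 4 + 2 * K" unfolding Z_def by linarith
        hence "\<bar>\<epsilon> * Z\<bar> \<le> \<rho> p * (4 + 2 * K)" using \<rho>(1)[of p] pos by (intro abs_mult_le) auto
        moreover have "\<bar>s * W\<bar> \<le> C * \<rho> p" using L[OF p] s by (auto simp: W_def \<rho>_def)
        moreover have "- \<epsilon> * (\<epsilon> * zxx p + s * wxx p + (\<epsilon> * zyy p + s * wyy p)) - b1 p * (\<epsilon> * zx p + s * wx p)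
          - b2 p * (\<epsilon> * zy p + s * wy p) = \<epsilon> * Z + s * W"
          by (simp add: Z_def W_def algebra_simps)
        moreover have "(C + 4 + 2 * K) * \<rho> p = \<rho> p * (4 + 2 * K) + C * \<rho> p" by (simp add: algebra_simps)
        ultimately show ?thesis by linarith
      qed
      show "integral (square c) (\<lambda>p. (C + 4 + 2 * K) * \<rho> p) \<le> (C + 4 + 2 * K) * (\<epsilon> * (1 + 2 / \<gamma>))"
        if "0 < c" "c < 1/2" for c
        using integral_layer_weight_le[OF pos(1,3) that] pos K0 by (simp add: \<rho>_def mult_left_mono)
    qed (use pos M0 \<delta> in \<open>auto intro!: continuous_intros \<rho>c\<close>)
    also have "\<dots> = \<epsilon> * (\<epsilon> * Q)" unfolding Q_def by (simp add: power2_eq_square algebra_simps)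
    finally show ?thesis using pos by simp
  qed
  have pw: "(wx p)\<^sup>2 + (wy p)\<^sup>2 \<le> 4 * E 1 p + 4 * E (- 1) p + 4 * \<epsilon>\<^sup>2" if p: "p \<in> square a" for p
  proof -
    have pO: "p \<in> Omega" using p square_subset_Omega pos by blast
    have E0: "0 \<le> E s p" for s
      unfolding E_def using trunc_sq_bounds(5)[OF \<delta>, of "max 0 (v s p - \<delta>)"] by (intro mult_nonneg_nonneg) auto
    obtain x y where xy: "p = (x, y)" by fastforce
    have "a * a * (a * a) \<le> bubble p"
      unfolding bubble_def xy using p pos xy by (intro mult_mono) auto
    hence bub: "2 * \<delta> \<le> \<epsilon> * bubble p" using pos by (simp add: \<delta>_def eval_nat_numeral mult.assoc)
    \<comment> \<open>The sign that makes s w nonnegative at p, so that adding the bubble lifts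
      \<open>v s\<close> above the level.\<close>
    define s :: real where "s = (if w p \<ge> 0 then 1 else - 1)"
    have s: "s = 1 \<or> s = - 1" "s * w p \<ge> 0" by (auto simp: s_def)
    have "\<delta> \<le> max 0 (v s p - \<delta>)" using bub s(2) \<delta> by (simp add: v_def)
    hence "1/2 \<le> trunc_sq'' \<delta> (max 0 (v s p - \<delta>))" using \<delta> by (intro trunc_sq_bounds(6)) auto
    hence "1/2 * ((\<epsilon> * zx p + s * wx p)\<^sup>2 + (\<epsilon> * zy p + s * wy p)\<^sup>2) \<le> E s p"
      unfolding E_def by (rule mult_right_mono) simp
    moreover have "h\<^sup>2 \<le> 2 * (\<epsilon> * k + s * h)\<^sup>2 + 2 * \<epsilon>\<^sup>2" if "\<bar>k\<bar> \<le> 1" for h k :: real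
    proof -
      \<comment> \<open>Expanding this square gives the inequality for (s h)^2 in the next
        line.\<close>
      have "0 \<le> (2 * (\<epsilon> * k) + s * h)\<^sup>2" by simp
      hence "(s * h)\<^sup>2 \<le> 2 * (\<epsilon> * k + s * h)\<^sup>2 + 2 * (\<epsilon> * k)\<^sup>2"
        by (simp add: power2_eq_square algebra_simps)
      moreover have "(s * h)\<^sup>2 = h\<^sup>2" using s(1) by auto
      moreover have "(\<epsilon> * k)\<^sup>2 \<le> \<epsilon>\<^sup>2 * 1"
        unfolding power_mult_distrib using that by (intro mult_left_mono) (auto simp: abs_square_le_1)
      ultimately show ?thesis by linarith
    qed
    note this[OF zb(3)[OF pO], of "wx p"] this[OF zb(4)[OF pO], of "wy p"]
    ultimately have "(wx p)\<^sup>2 + (wy p)\<^sup>2 \<le> 4 * E s p + 4 * \<epsilon>\<^sup>2" by simp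
    thus ?thesis using s(1) E0[of 1] E0[of "- 1"] by auto
  qed
  have sub: "square a \<subseteq> Omega" using pos by (intro square_subset_Omega)
  have Ec: "continuous_on Omega (E s)" for s
  proof -
    have "max 0 (v s p - \<delta>) + \<delta> \<noteq> 0" for p using \<delta> by (auto simp: max_def)
    moreover have "continuous_on Omega (v s)" "continuous_on Omega (\<lambda>p. \<epsilon> * zx p + s * wx p)"
      "continuous_on Omega (\<lambda>p. \<epsilon> * zy p + s * wy p)"
      using C2v[of s] unfolding C2_partials_def by blast+
    ultimately show ?thesis unfolding E_def[abs_def] trunc_sq''_def
      by (intro continuous_on_mult continuous_on_add[where f = "\<lambda>p. (_ p)\<^sup>2"] continuous_on_power
          continuous_on_diff continuous_on_divide continuous_on_const continuous_on_max
          continuous_on_add[where g = "\<lambda>_. \<delta>"]) auto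
  qed
  have Ec': "continuous_on (square a) (E s)" for s
    using Ec sub by (rule continuous_on_subset)
  hence Ei: "E s integrable_on square a" for s by (rule integrable_continuous)
  have "continuous_on (square a) (\<lambda>p. (wx p)\<^sup>2 + (wy p)\<^sup>2)"
    using w(1) sub unfolding C2_partials_def by (auto intro!: continuous_intros intro: continuous_on_subset)
  hence "integral (square a) (\<lambda>p. (wx p)\<^sup>2 + (wy p)\<^sup>2)
      \<le> integral (square a) (\<lambda>p. 4 * E 1 p + 4 * E (- 1) p + 4 * \<epsilon>\<^sup>2)"
    using pw by (intro integral_le integrable_continuous) (auto intro!: continuous_intros Ec')
  also have "\<dots> = 4 * integral (square a) (E 1) + 4 * integral (square a) (E (- 1))
      + measure lborel (square a) * (4 * \<epsilon>\<^sup>2)"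
  proof (rule integral_unique)
    show "((\<lambda>p. 4 * E 1 p + 4 * E (- 1) p + 4 * \<epsilon>\<^sup>2) has_integral
        4 * integral (square a) (E 1) + 4 * integral (square a) (E (- 1)) + measure lborel (square a) * (4 * \<epsilon>\<^sup>2))
        (square a)"
      using has_integral_const[of "4 * \<epsilon>\<^sup>2" "(a, a)" "(1 - a, 1 - a)"]
      by (intro has_integral_add has_integral_mult_right integrable_integral Ei) simp
  qed
  also have "\<dots> \<le> 4 * (\<epsilon> * Q) + 4 * (\<epsilon> * Q) + 1 * (4 * \<epsilon>\<^sup>2)"
  proof (intro add_mono mult_left_mono energy mult_right_mono)
    have "measure lborel (square a) = (1 - 2 * a) * (1 - 2 * a)" using pos by (simp add: content_Pair)
    also have "\<dots> \<le> 1 * 1" using pos by (intro mult_mono) auto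
    finally show "measure lborel (square a) \<le> 1" by simp
  qed auto
  also have "\<dots> \<le> \<epsilon> * (8 * Q + 4)"
    using pos by (simp add: power2_eq_square algebra_simps)
  finally show ?thesis unfolding Q_def .
qed

section \<open>Traces, cut-offs and the expansion\<close>

lemma finite_family_bounded:
  fixes F :: "(real \<times> real \<Rightarrow> real) set"
  assumes "finite F" "\<And>h. h \<in> F \<Longrightarrow> continuous_on (closure Omega) h"
  obtains K where "K \<ge> 1" "\<And>h p. h \<in> F \<Longrightarrow> p \<in> closure Omega \<Longrightarrow> \<bar>h p\<bar> \<le> K"
proof -
  have "bounded (h ` closure Omega)" if "h \<in> F" for h
    using compact_continuous_image[OF assms(2)[OF that] compact_closure_Omega] by (rule compact_imp_bounded)
  hence "bounded (\<Union>h\<in>F. h ` closure Omega)" using assms(1) by (intro bounded_UN) auto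
  then obtain K where "\<And>h p. h \<in> F \<Longrightarrow> p \<in> closure Omega \<Longrightarrow> \<bar>h p\<bar> \<le> K"
    unfolding bounded_iff by fastforce
  with that[of "max 1 K"] show thesis by (meson max.cobounded1 max.coboundedI2)
qed

text \<open>Differentiability relative to the closed square yields ordinary tangential derivatives
  in the interior of an edge, so t = 0 is covered.\<close>

lemma C2_bounded_trace:
  assumes v: "\<And>p. p \<in> closure Omega \<Longrightarrow> (v has_derivative (\<lambda>h. vx p * fst h + vy p * snd h)) (at p within closure Omega)"
    and vx: "\<And>p. p \<in> closure Omega \<Longrightarrow> (vx has_derivative (\<lambda>h. vxx p * fst h + vxy p * snd h)) (at p within closure Omega)"
    and vy: "\<And>p. p \<in> closure Omega \<Longrightarrow> (vy has_derivative (\<lambda>h. vyx p * fst h + vyy p * snd h)) (at p within closure Omega)"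
    and c: "continuous_on (closure Omega) vxx" "continuous_on (closure Omega) vyy"
    and K: "\<And>h p. h \<in> {v, vx, vy, vxx, vyy} \<Longrightarrow> p \<in> closure Omega \<Longrightarrow> \<bar>h p\<bar> \<le> K"
    and t: "0 \<le> t" "t \<le> 1"
  shows "C2_bounded K (\<lambda>x. v (x, t)) (\<lambda>x. vx (x, t)) (\<lambda>x. vxx (x, t))"
    and "C2_bounded K (\<lambda>y. v (t, y)) (\<lambda>y. vy (t, y)) (\<lambda>y. vyy (t, y))"
proof -
  have slice: "((\<lambda>x. h (x, t)) has_real_derivative a) (at s)"
    if "(h has_derivative (\<lambda>k. a * fst k + b * snd k)) (at (s, t) within closure Omega)" "s \<in> {0<..<1}" for h a b s
  proof -
    have "((\<lambda>x. h (x, t)) has_real_derivative a) (at s within {0<..<1})"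
      by (rule DERIV_subset[OF has_real_derivative_slice(1)[OF that(1)]]) (use t in auto)
    thus ?thesis using that(2) by (simp add: at_within_open[OF that(2)])
  qed
  have slice': "((\<lambda>y. h (t, y)) has_real_derivative b) (at s)"
    if "(h has_derivative (\<lambda>k. a * fst k + b * snd k)) (at (t, s) within closure Omega)" "s \<in> {0<..<1}" for h a b s
  proof -
    have "((\<lambda>y. h (t, y)) has_real_derivative b) (at s within {0<..<1})"
      by (rule DERIV_subset[OF has_real_derivative_slice(2)[OF that(1)]]) (use t in auto)
    thus ?thesis using that(2) by (simp add: at_within_open[OF that(2)])
  qed
  have mem: "(s, t) \<in> closure Omega" "(t, s) \<in> closure Omega" if "s \<in> {0<..<1}" for s
    using that t by auto
  have c': "continuous_on {0<..<1} (\<lambda>x. vxx (x, t))" "continuous_on {0<..<1} (\<lambda>y. vyy (t, y))"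
    by (rule continuous_on_compose2[OF c(1)] continuous_on_compose2[OF c(2)];
        use mem in \<open>auto intro!: continuous_intros\<close>)+
  show "C2_bounded K (\<lambda>x. v (x, t)) (\<lambda>x. vx (x, t)) (\<lambda>x. vxx (x, t))"
    unfolding C2_bounded_def using slice[OF v] slice[OF vx] c'(1) K mem by blast
  show "C2_bounded K (\<lambda>y. v (t, y)) (\<lambda>y. vy (t, y)) (\<lambda>y. vyy (t, y))"
    unfolding C2_bounded_def using slice'[OF v] slice'[OF vy] c'(2) K mem by blast
qed

lemma cutoff_derivs:
  assumes "cutoff \<sigma>"
  shows "(\<sigma> has_real_derivative deriv \<sigma> t) (at t)"
    "(deriv \<sigma> has_real_derivative deriv (deriv \<sigma>) t) (at t)"
    "continuous_on S \<sigma>" "continuous_on S (deriv \<sigma>)" "continuous_on S (deriv (deriv \<sigma>))"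
proof -
  have d: "((deriv ^^ n) \<sigma> has_real_derivative (deriv ^^ Suc n) \<sigma> t) (at t)" for n t
  proof -
    have "(deriv ^^ n) \<sigma> differentiable (at t)" using assms by (auto simp: cutoff_def)
    thus ?thesis by (simp add: DERIV_deriv_iff_real_differentiable)
  qed
  have c: "continuous_on S ((deriv ^^ n) \<sigma>)" for n S
    by (rule DERIV_continuous_on[OF has_field_derivative_at_within[OF d[of n]]])
  show "(\<sigma> has_real_derivative deriv \<sigma> t) (at t)"
    "(deriv \<sigma> has_real_derivative deriv (deriv \<sigma>) t) (at t)"
    "continuous_on S \<sigma>" "continuous_on S (deriv \<sigma>)" "continuous_on S (deriv (deriv \<sigma>))"
    using d[of 0] d[of 1] c[of S 0] c[of S 1] c[of S 2] by (simp_all add: eval_nat_numeral)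
qed

lemma C2_bounded_cutoff:
  assumes "cutoff \<sigma>"
    and "\<And>h p. h \<in> {\<lambda>p. \<sigma> (fst p), \<lambda>p. deriv \<sigma> (fst p), \<lambda>p. deriv (deriv \<sigma>) (fst p)}
      \<Longrightarrow> p \<in> closure Omega \<Longrightarrow> \<bar>h p\<bar> \<le> K"
  shows "C2_bounded K \<sigma> (deriv \<sigma>) (deriv (deriv \<sigma>))"
proof -
  have "\<bar>\<sigma> s\<bar> \<le> K" "\<bar>deriv \<sigma> s\<bar> \<le> K" "\<bar>deriv (deriv \<sigma>) s\<bar> \<le> K" if "s \<in> {0<..<1}" for s
    using assms(2)[of "\<lambda>p. \<sigma> (fst p)" "(s, 0)"] assms(2)[of "\<lambda>p. deriv \<sigma> (fst p)" "(s, 0)"]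
      assms(2)[of "\<lambda>p. deriv (deriv \<sigma>) (fst p)" "(s, 0)"] that by auto
  thus ?thesis using cutoff_derivs[OF assms(1)] unfolding C2_bounded_def by blast
qed

text \<open>The mean value inequality on a convex set; the factor 2 comes from bounding the two
  partial derivatives separately in the operator norm.\<close>

lemma lipschitz_on_closure_Omega:
  assumes v: "\<And>p. p \<in> closure Omega \<Longrightarrow> (v has_derivative (\<lambda>h. vx p * fst h + vy p * snd h)) (at p within closure Omega)"
    and K: "\<And>p. p \<in> closure Omega \<Longrightarrow> \<bar>vx p\<bar> \<le> K" "\<And>p. p \<in> closure Omega \<Longrightarrow> \<bar>vy p\<bar> \<le> K"
    and "(x, y) \<in> closure Omega" "(x', y') \<in> closure Omega"
  shows "\<bar>v (x, y) - v (x', y')\<bar> \<le> 2 * K * (\<bar>x - x'\<bar> + \<bar>y - y'\<bar>)"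
proof -
  have K0: "K \<ge> 0" using K(1)[OF assms(4)] by linarith
  have on: "onorm (\<lambda>h. vx p * fst h + vy p * snd h) \<le> 2 * K" if p: "p \<in> closure Omega" for p
  proof (rule onorm_le)
    fix h :: "real \<times> real"
    have "\<bar>vx p * fst h\<bar> \<le> K * norm h" "\<bar>vy p * snd h\<bar> \<le> K * norm h"
      using K[OF p] norm_fst_le[of "fst h" "snd h"] norm_snd_le[of "snd h" "fst h"]
      by (intro abs_mult_le; simp)+
    thus "norm (vx p * fst h + vy p * snd h) \<le> 2 * K * norm h" by (simp add: algebra_simps)
  qed
  have "convex (closure Omega)"
    by (simp add: closure_Omega convex_Times)
  from differentiable_bound[OF this v on assms(4,5)]
  have "\<bar>v (x, y) - v (x', y')\<bar> \<le> 2 * K * norm (x - x', y - y')" by simp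
  also have "\<dots> \<le> 2 * K * (\<bar>x - x'\<bar> + \<bar>y - y'\<bar>)"
    using K0 norm_Pair_le[of "x - x'" "y - y'"] by (intro mult_left_mono) auto
  finally show ?thesis .
qed

lemma theta_B_eq: "theta_B \<sigma> b2 u0 \<epsilon> = (\<lambda>p. - \<sigma> (snd p) * u0 (fst p, 0) * exp (- b2 (fst p, 0) * snd p / \<epsilon>))"
  by (simp add: theta_B_def case_prod_unfold)

lemma theta_L_eq: "theta_L \<sigma> b1 u0 \<epsilon> = (\<lambda>p. - \<sigma> (fst p) * u0 (0, snd p) * exp (- b1 (0, snd p) * fst p / \<epsilon>))"
  by (simp add: theta_L_def case_prod_unfold)

lemma eta_eq: "eta \<sigma> \<tau> b1 b2 u0 \<epsilon> = (\<lambda>p. \<sigma> (fst p) * \<tau> (snd p) * u0 (0, 0) *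
    exp (- b1 (0, 0) * fst p / \<epsilon>) * exp (- b2 (0, 0) * snd p / \<epsilon>))"
  by (simp add: eta_def case_prod_unfold)

text \<open>On x = 0 the corrector \<theta>_L cancels u0, and \<eta> cancels the trace that
  \<theta>_B leaves there; y = 0 is symmetric. On x = 1 and y = 1 each term vanishes, through the
  boundary values of u0 or through a cut-off.\<close>

lemma remainder_boundary:
  assumes u: "\<forall>p\<in>frontier Omega. u p = 0" and u0: "\<forall>p\<in>closure Omega. fst p = 1 \<or> snd p = 1 \<longrightarrow> u0 p = 0"
    and \<sigma>: "cutoff \<sigma>B" "cutoff \<sigma>L" and p: "p \<in> frontier Omega"
  shows "u p - u0 p - theta_B \<sigma>B b2 u0 \<epsilon> p - theta_L \<sigma>L b1 u0 \<epsilon> p - eta \<sigma>L \<sigma>B b1 b2 u0 \<epsilon> p = 0"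
proof -
  obtain x y where xy: "p = (x, y)" by fastforce
  have in_c: "(x, y) \<in> closure Omega" "(x, y) \<notin> Omega" using p xy by (auto simp: frontier_Omega)
  have s: "\<sigma>B 0 = 1" "\<sigma>L 0 = 1" "\<sigma>B 1 = 0" "\<sigma>L 1 = 0" using \<sigma> by (auto simp: cutoff_def)
  have z: "u0 (1, t) = 0" "u0 (t, 1) = 0" if "0 \<le> t" "t \<le> 1" for t using u0 that by auto
  have up: "u (x, y) = 0" using u p xy by auto
  consider "x = 0" | "y = 0" | "x = 1" | "y = 1" using in_c by auto
  thus ?thesis
    by cases (use in_c up in \<open>auto simp: xy s z theta_B_def theta_L_def eta_def\<close>)
qed

lemma layer_term_le:
  fixes \<epsilon> \<gamma> \<beta> t K g s :: real
  assumes "\<bar>s\<bar> \<le> K" "\<bar>g\<bar> \<le> K" "\<epsilon> > 0" "\<gamma> \<le> \<beta>" "t \<ge> 0"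
  shows "\<bar>- s * g * exp (- \<beta> * t / \<epsilon>)\<bar> \<le> K\<^sup>2 * exp (- \<gamma> * t / \<epsilon>)"
proof -
  have "\<gamma> * t / \<epsilon> \<le> \<beta> * t / \<epsilon>" using assms by (intro divide_right_mono mult_right_mono) auto
  hence "\<bar>exp (- \<beta> * t / \<epsilon>)\<bar> \<le> exp (- \<gamma> * t / \<epsilon>)" by simp
  moreover have "\<bar>- s * g\<bar> \<le> K * K" using assms by (intro abs_mult_le) auto
  ultimately show ?thesis unfolding power2_eq_square by (rule abs_mult_le[rotated])
qed

text \<open>By continuity b1 and b2 are nonnegative on the closed square, so the nonvanishing normal
  components are positive. Every boundary point lies on an edge where one component is normal, hence
  b1 + b2 is positive everywhere, and compactness makes the bounds uniform.\<close>

lemma coefficient_lower_bounds: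
  assumes c: "continuous_on (closure Omega) b1" "continuous_on (closure Omega) b2"
    and pos: "\<forall>p\<in>Omega. b1 p > 0 \<and> b2 p > 0" and nc: "noncharacteristic b1 b2"
  obtains \<mu> c0 where "\<mu> > 0" "c0 > 0"
    "\<And>t. 0 \<le> t \<Longrightarrow> t \<le> 1 \<Longrightarrow> b1 (0, t) \<ge> \<mu>" "\<And>t. 0 \<le> t \<Longrightarrow> t \<le> 1 \<Longrightarrow> b2 (t, 0) \<ge> \<mu>"
    "\<And>p. p \<in> closure Omega \<Longrightarrow> b1 p + b2 p \<ge> c0"
proof -
  have b0: "b1 p \<ge> 0" "b2 p \<ge> 0" if "p \<in> closure Omega" for p
    using continuous_ge_on_closure[OF c(1) that, of 0] continuous_ge_on_closure[OF c(2) that, of 0] pos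
    by (auto intro: less_imp_le)
  have minimum: "\<exists>m>0. \<forall>t\<in>{0..1}. m \<le> h t" if h: "continuous_on {0..1} h" "\<And>t. t \<in> {0..1} \<Longrightarrow> h t > 0"
    for h :: "real \<Rightarrow> real"
  proof -
    obtain t where "t \<in> {0..1}" "\<forall>s\<in>{0..1}. h t \<le> h s"
      using continuous_attains_inf[OF _ _ h(1)] by auto
    with h(2) show ?thesis by blast
  qed
  have "continuous_on {0..1} (\<lambda>t. b1 (0, t))" "continuous_on {0..1} (\<lambda>t. b2 (t, 0))"
    by (rule continuous_on_compose2[OF c(1)] continuous_on_compose2[OF c(2)]; auto intro!: continuous_intros)+
  moreover have "b1 (0, t) > 0" "b2 (t, 0) > 0" if "t \<in> {0..1}" for t
    using nc that b0[of "(0, t)"] b0[of "(t, 0)"] by (force simp: noncharacteristic_def less_le)+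
  ultimately obtain m1 m2 where m: "m1 > 0" "m2 > 0" "\<forall>t\<in>{0..1}. m1 \<le> b1 (0, t)" "\<forall>t\<in>{0..1}. m2 \<le> b2 (t, 0)"
    using minimum[of "\<lambda>t. b1 (0, t)"] minimum[of "\<lambda>t. b2 (t, 0)"] by blast
  have sum_pos: "b1 p + b2 p > 0" if p: "p \<in> closure Omega" for p
  proof -
    obtain x y where xy: "p = (x, y)" by fastforce
    have "b1 (x, y) > 0 \<or> b2 (x, y) > 0"
    proof (cases "(x, y) \<in> Omega")
      case True
      thus ?thesis using pos by blast
    next
      case False
      hence "x = 0 \<or> x = 1 \<or> y = 0 \<or> y = 1" using p xy by auto
      hence "b1 (x, y) \<noteq> 0 \<or> b2 (x, y) \<noteq> 0" using nc p xy by (auto simp: noncharacteristic_def)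
      thus ?thesis using b0[OF p] xy by force
    qed
    thus ?thesis using b0[OF p] xy by force
  qed
  have "closure Omega \<noteq> {}" by (simp add: closure_Omega)
  then obtain q where q: "q \<in> closure Omega" "\<forall>p\<in>closure Omega. b1 q + b2 q \<le> b1 p + b2 p"
    using continuous_attains_inf[OF compact_closure_Omega _ continuous_on_add[OF c]] by auto
  show thesis
    by (rule that[of "min m1 m2" "b1 q + b2 q"]) (use m q sum_pos in \<open>auto intro: min.coboundedI1 min.coboundedI2\<close>)
qed

section \<open>Uniform estimates for the remainder and for u - u0\<close>

text \<open>The constant is chosen before \<epsilon> and u, and is built only from bounds on the
  limit data and the cut-offs: this is the uniformity in \<epsilon>.\<close>

lemma expansion_estimate:
  assumes b: "Ck_on 2 (closure Omega) b1" "Ck_on 2 (closure Omega) b2"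
    and pos: "\<forall>p\<in>Omega. b1 p > 0 \<and> b2 p > 0" and nc: "noncharacteristic b1 b2"
    and u0: "Ck_on 2 (closure Omega) u0" and lim: "limit_solution b1 b2 f u0"
    and \<sigma>B: "cutoff \<sigma>B" and \<sigma>L: "cutoff \<sigma>L"
  obtains \<kappa> where "\<kappa> \<ge> 0"
    "\<And>\<epsilon> u w. 0 < \<epsilon> \<Longrightarrow> \<epsilon> \<le> 1 \<Longrightarrow> perturbed_solution b1 b2 f \<epsilon> u \<Longrightarrow>
       w = (\<lambda>p. u p - u0 p - theta_B \<sigma>B b2 u0 \<epsilon> p - theta_L \<sigma>L b1 u0 \<epsilon> p - eta \<sigma>L \<sigma>B b1 b2 u0 \<epsilon> p) \<Longrightarrow>
       in_L2 w \<and> in_L2 (grad w) \<and> eps_norm \<epsilon> w \<le> \<kappa> * \<epsilon>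
       \<and> in_L2 (\<lambda>p. u p - u0 p) \<and> L2_norm (\<lambda>p. u p - u0 p) \<le> \<kappa> * sqrt \<epsilon>"
proof -
  let ?S = "closure Omega"
  obtain b1x b1y b1xx b1xy b1yx b1yy where b1_all:
    "\<forall>p\<in>?S. (b1 has_derivative (\<lambda>h. b1x p * fst h + b1y p * snd h)) (at p within ?S)"
    "\<forall>p\<in>?S. (b1x has_derivative (\<lambda>h. b1xx p * fst h + b1xy p * snd h)) (at p within ?S)"
    "\<forall>p\<in>?S. (b1y has_derivative (\<lambda>h. b1yx p * fst h + b1yy p * snd h)) (at p within ?S)"
    "continuous_on ?S b1" "continuous_on ?S b1x" "continuous_on ?S b1y" "continuous_on ?S b1xx" "continuous_on ?S b1yy"
    using b(1) by (rule Ck_on_2E) (rule that)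
  note b1 = b1_all(1-3)[rule_format] b1_all(4-8)
  obtain b2x b2y b2xx b2xy b2yx b2yy where b2_all:
    "\<forall>p\<in>?S. (b2 has_derivative (\<lambda>h. b2x p * fst h + b2y p * snd h)) (at p within ?S)"
    "\<forall>p\<in>?S. (b2x has_derivative (\<lambda>h. b2xx p * fst h + b2xy p * snd h)) (at p within ?S)"
    "\<forall>p\<in>?S. (b2y has_derivative (\<lambda>h. b2yx p * fst h + b2yy p * snd h)) (at p within ?S)"
    "continuous_on ?S b2" "continuous_on ?S b2x" "continuous_on ?S b2y" "continuous_on ?S b2xx" "continuous_on ?S b2yy"
    using b(2) by (rule Ck_on_2E) (rule that)
  note b2 = b2_all(1-3)[rule_format] b2_all(4-8)
  obtain ux uy uxx uxy uyx uyy where u0_all: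
    "\<forall>p\<in>?S. (u0 has_derivative (\<lambda>h. ux p * fst h + uy p * snd h)) (at p within ?S)"
    "\<forall>p\<in>?S. (ux has_derivative (\<lambda>h. uxx p * fst h + uxy p * snd h)) (at p within ?S)"
    "\<forall>p\<in>?S. (uy has_derivative (\<lambda>h. uyx p * fst h + uyy p * snd h)) (at p within ?S)"
    "continuous_on ?S u0" "continuous_on ?S ux" "continuous_on ?S uy" "continuous_on ?S uxx" "continuous_on ?S uyy"
    using u0 by (rule Ck_on_2E) (rule that)
  note u0' = u0_all(1-3)[rule_format] u0_all(4-8)
  \<comment> \<open>Lifting the cut-offs to functions on the square lets one finite family F provide
    a bound for them and for all data.\<close>
  define cut where "cut \<sigma> = ({\<lambda>p. \<sigma> (fst p), \<lambda>p. deriv \<sigma> (fst p), \<lambda>p. deriv (deriv \<sigma>) (fst p)} :: (real \<times> real \<Rightarrow> real) set)"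
    for \<sigma> :: "real \<Rightarrow> real"
  have cut_c: "continuous_on ?S h" if "cutoff \<sigma>" "h \<in> cut \<sigma>" for \<sigma> and h :: "real \<times> real \<Rightarrow> real"
  proof -
    have "continuous_on ?S (\<lambda>p. g (fst p))" if "continuous_on UNIV g" for g :: "real \<Rightarrow> real"
      by (rule continuous_on_compose2[OF that]) (auto intro: continuous_intros)
    thus ?thesis using that(2) cutoff_derivs(3-5)[OF that(1), of UNIV] unfolding cut_def by blast
  qed
  define F where "F = {b1, b1x, b1y, b1xx, b1yy, b2, b2x, b2y, b2xx, b2yy, u0, ux, uy, uxx, uyy} \<union> cut \<sigma>B \<union> cut \<sigma>L"
  have "finite F" by (simp add: F_def cut_def)
  moreover have "continuous_on ?S h" if "h \<in> F" for h
    using that b1(4-8) b2(4-8) u0'(4-8) cut_c[OF \<sigma>B] cut_c[OF \<sigma>L] unfolding F_def by blast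
  ultimately obtain K0 where K0: "K0 \<ge> 1" "\<And>h p. h \<in> F \<Longrightarrow> p \<in> ?S \<Longrightarrow> \<bar>h p\<bar> \<le> K0"
    using finite_family_bounded by blast
  \<comment> \<open>Doubling K0 makes K a Lipschitz constant of b1 and b2 as well as a bound for
    every member of F.\<close>
  define K where "K = 2 * K0"
  have K1: "K \<ge> 1" using K0 by (simp add: K_def)
  have K: "\<bar>h p\<bar> \<le> K" if "h \<in> F" "p \<in> ?S" for h p
    using K0(2)[OF that] K0(1) by (simp add: K_def)
  have FI: "{b1, b1x, b1y, b1xx, b1yy} \<subseteq> F" "{b2, b2x, b2y, b2xx, b2yy} \<subseteq> F" "{u0, ux, uy, uxx, uyy} \<subseteq> F"
    "cut \<sigma>B \<subseteq> F" "cut \<sigma>L \<subseteq> F"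
    by (auto simp: F_def)
  have Lip: "\<bar>b1 (x, y) - b1 (x', y')\<bar> \<le> K * (\<bar>x - x'\<bar> + \<bar>y - y'\<bar>)"
    "\<bar>b2 (x, y) - b2 (x', y')\<bar> \<le> K * (\<bar>x - x'\<bar> + \<bar>y - y'\<bar>)"
    if "(x, y) \<in> ?S" "(x', y') \<in> ?S" for x y x' y'
    unfolding K_def using FI
    by (intro lipschitz_on_closure_Omega[OF b1(1) _ _ that] lipschitz_on_closure_Omega[OF b2(1) _ _ that] K0(2); blast)+
  obtain \<mu> c0 where \<mu>: "\<mu> > 0" "c0 > 0"
    "\<And>t. 0 \<le> t \<Longrightarrow> t \<le> 1 \<Longrightarrow> b1 (0, t) \<ge> \<mu>" "\<And>t. 0 \<le> t \<Longrightarrow> t \<le> 1 \<Longrightarrow> b2 (t, 0) \<ge> \<mu>"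
    "\<And>p. p \<in> ?S \<Longrightarrow> b1 p + b2 p \<ge> c0"
    using coefficient_lower_bounds[OF b1(4) b2(4) pos nc] by metis
  define \<gamma> where "\<gamma> = \<mu> / 3"
  \<comment> \<open>Within distance r of an edge the coefficients change by at most K r = \<gamma>,
    so 3 \<gamma> on the edge leaves 2 \<gamma> in the strip.\<close>
  define r where "r = \<gamma> / K"
  have \<gamma>: "\<gamma> > 0" using \<mu> by (simp add: \<gamma>_def)
  have r: "r > 0" "K * r = \<gamma>" using \<gamma> K1 by (auto simp: r_def)
  have edge: "b1 (0, t) \<ge> 3 * \<gamma>" "b2 (t, 0) \<ge> 3 * \<gamma>" if "0 \<le> t" "t \<le> 1" for t
    using \<mu>(3,4)[OF that] by (simp_all add: \<gamma>_def)
  have near: "b1 p \<ge> 2 * \<gamma>" if "p \<in> Omega" "fst p \<le> r" for p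
  proof -
    obtain x y where xy: "p = (x, y)" by fastforce
    have "\<bar>b1 (x, y) - b1 (0, y)\<bar> \<le> K * (\<bar>x - 0\<bar> + \<bar>y - y\<bar>)" using that xy by (intro Lip) auto
    also have "\<dots> \<le> \<gamma>" using that xy K1 r by (auto simp flip: r(2) intro!: mult_left_mono)
    finally show ?thesis using edge(1)[of y] that xy by auto
  qed
  have near': "b2 p \<ge> 2 * \<gamma>" if "p \<in> Omega" "snd p \<le> r" for p
  proof -
    obtain x y where xy: "p = (x, y)" by fastforce
    have "\<bar>b2 (x, y) - b2 (x, 0)\<bar> \<le> K * (\<bar>x - x\<bar> + \<bar>y - 0\<bar>)" using that xy by (intro Lip) auto
    also have "\<dots> \<le> \<gamma>" using that xy K1 r by (auto simp flip: r(2) intro!: mult_left_mono)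
    finally show ?thesis using edge(2)[of x] that xy by auto
  qed
  have sub: "p \<in> ?S" if "p \<in> Omega" for p using that closure_subset by blast
  have trace: "C2_bounded K (\<lambda>x. u0 (x, 0)) (\<lambda>x. ux (x, 0)) (\<lambda>x. uxx (x, 0))"
    "C2_bounded K (\<lambda>y. u0 (0, y)) (\<lambda>y. uy (0, y)) (\<lambda>y. uyy (0, y))"
    "C2_bounded K (\<lambda>x. b2 (x, 0)) (\<lambda>x. b2x (x, 0)) (\<lambda>x. b2xx (x, 0))"
    "C2_bounded K (\<lambda>y. b1 (0, y)) (\<lambda>y. b1y (0, y)) (\<lambda>y. b1yy (0, y))"
    using FI
    by (intro C2_bounded_trace[OF u0'(1-3,7,8)] C2_bounded_trace[OF b1(1-3,7,8)] C2_bounded_trace[OF b2(1-3,7,8)] K;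
        force)+
  have cut: "C2_bounded K \<sigma>B (deriv \<sigma>B) (deriv (deriv \<sigma>B))" "C2_bounded K \<sigma>L (deriv \<sigma>L) (deriv (deriv \<sigma>L))"
    using FI(4,5) by (intro C2_bounded_cutoff[OF \<sigma>B] C2_bounded_cutoff[OF \<sigma>L] K; auto simp: cut_def)+
  have \<sigma>b: "\<bar>\<sigma>B t\<bar> \<le> K" "\<bar>\<sigma>L t\<bar> \<le> K" if "0 < t" "t < 1" for t
    using cut that by (auto simp: C2_bounded_def)
  have C2b: "C2_partials b1 b1x b1y b1xx b1yy" "C2_partials b2 b2x b2y b2xx b2yy" "C2_partials u0 ux uy uxx uyy"
    using C2_partialsI[OF closure_subset b1] C2_partialsI[OF closure_subset b2] C2_partialsI[OF closure_subset u0']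
    by blast+
  define G where "G = 1 + 1 / \<gamma> + 2 / \<gamma>\<^sup>2"
  define C1 where "C1 = 8 * K ^ 4 * G"
  define C2 where "C2 = 8 * K ^ 5 * G\<^sup>2"
  define C where "C = 2 * K + C1 + C2"
  have C0: "C1 \<ge> 0" "C2 \<ge> 0" "C \<ge> 0" using K1 \<gamma> by (auto simp: C_def C1_def C2_def G_def)
  define B where "B = C / \<gamma>\<^sup>2 + 1"
  define M where "M = 2 * ((C + 4 * B * \<gamma> / r + 1) / c0) + 2 * B"
  have B0: "B \<ge> 0" using C0 by (auto simp: B_def)
  have M0: "M \<ge> 0" using C0 B0 \<gamma> r \<mu> by (auto simp: M_def intro!: add_nonneg_nonneg divide_nonneg_nonneg)
  define Q where "Q = 8 * ((M + 1) * ((C + 4 + 2 * K) * (1 + 2 / \<gamma>)) + (2 * K) * (M + 1)\<^sup>2 / 2) + 4"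
  have Q0: "Q \<ge> 0" using M0 C0 K1 \<gamma> by (auto simp: Q_def intro!: add_nonneg_nonneg mult_nonneg_nonneg)
  define N where "N = M + K\<^sup>2 + K\<^sup>2 + K ^ 3"
  have N0: "N \<ge> 0" using M0 K1 by (simp add: N_def)
  define \<kappa> where "\<kappa> = M * sqrt (1 + 2 / \<gamma>) + sqrt Q + N * sqrt (3 * (1 + 2 / \<gamma>))"
  show thesis
  proof (rule that[of \<kappa>])
    show "\<kappa> \<ge> 0" unfolding \<kappa>_def using M0 Q0 N0 \<gamma> by simp
    fix \<epsilon> :: real and u w
    assume \<epsilon>: "0 < \<epsilon>" "\<epsilon> \<le> 1" and sol: "perturbed_solution b1 b2 f \<epsilon> u"
      and w_eq: "w = (\<lambda>p. u p - u0 p - theta_B \<sigma>B b2 u0 \<epsilon> p - theta_L \<sigma>L b1 u0 \<epsilon> p - eta \<sigma>L \<sigma>B b1 b2 u0 \<epsilon> p)"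
    define \<rho> where "\<rho> p = \<epsilon> + exp (- \<gamma> * fst p / \<epsilon>) + exp (- \<gamma> * snd p / \<epsilon>)" for p
    have "Ck_on 2 Omega u" using sol by (simp add: perturbed_solution_def)
    then obtain vx vy vxx vxy vyx vyy where v_all:
      "\<forall>p\<in>Omega. (u has_derivative (\<lambda>h. vx p * fst h + vy p * snd h)) (at p within Omega)"
      "\<forall>p\<in>Omega. (vx has_derivative (\<lambda>h. vxx p * fst h + vxy p * snd h)) (at p within Omega)"
      "\<forall>p\<in>Omega. (vy has_derivative (\<lambda>h. vyx p * fst h + vyy p * snd h)) (at p within Omega)"
      "continuous_on Omega u" "continuous_on Omega vx" "continuous_on Omega vy"
      "continuous_on Omega vxx" "continuous_on Omega vyy"
      by (rule Ck_on_2E) (rule that)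
    note v = v_all(1-3)[rule_format] v_all(4-8)
    have C2u: "C2_partials u vx vy vxx vyy" by (rule C2_partialsI[OF order_refl v])
    have bK: "\<bar>b1 p\<bar> \<le> K" "\<bar>b2 p\<bar> \<le> K" "\<bar>u0 p\<bar> \<le> K" if "p \<in> ?S" for p
      using K[OF _ that] FI by blast+
    have Lp: "\<bar>b1 (x, y) - b1 (x', y')\<bar> \<le> K * (\<bar>x - x'\<bar> + \<bar>y - y'\<bar>)"
      "\<bar>b2 (x, y) - b2 (x', y')\<bar> \<le> K * (\<bar>x - x'\<bar> + \<bar>y - y'\<bar>)"
      if "0 \<le> x" "x \<le> 1" "0 \<le> y" "y \<le> 1" "0 \<le> x'" "x' \<le> 1" "0 \<le> y'" "y' \<le> 1" for x y x' y'
      using Lip[of x y x' y'] that by auto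
    obtain Bx By Bxx Byy where TB: "C2_partials (theta_B \<sigma>B b2 u0 \<epsilon>) Bx By Bxx Byy"
      "\<And>p. p \<in> Omega \<Longrightarrow> \<bar>- \<epsilon> * (Bxx p + Byy p) - b1 p * Bx p - b2 p * By p\<bar> \<le> C1 * exp (- \<gamma> * snd p / \<epsilon>)"
    proof (rule layer_residual_le[OF cut(1) trace(1,3) K1 \<epsilon> \<gamma>, where a = b1 and c = b2])
      show "2 * \<gamma> \<le> b2 (s, 0)" if "s \<in> {0<..<1}" for s using edge(2)[of s] that \<gamma> by auto
      show "\<bar>b1 p\<bar> \<le> K" "\<bar>b2 p\<bar> \<le> K" if "p \<in> Omega" for p using bK[OF sub[OF that]] by auto
      show "\<bar>b2 (fst p, 0) - b2 p\<bar> \<le> K * snd p" if "p \<in> Omega" for p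
        using Lp(2)[of "fst p" 0 "fst p" "snd p"] that by (cases p) auto
    qed (use that in \<open>simp add: theta_B_eq C1_def G_def\<close>)
    \<comment> \<open>In exchanged coordinates the layer at x = 0 lies at the bottom, with b2 as
      tangential and b1 as normal coefficient.\<close>
    obtain Ly' Lx' Lyy' Lxx' where TL': "C2_partials (\<lambda>p. - \<sigma>L (snd p) * u0 (0, fst p) * exp (- b1 (0, fst p) * snd p / \<epsilon>)) Ly' Lx' Lyy' Lxx'"
      "\<And>p. p \<in> Omega \<Longrightarrow> \<bar>- \<epsilon> * (Lyy' p + Lxx' p) - b2 (prod.swap p) * Ly' p - b1 (prod.swap p) * Lx' p\<bar>
         \<le> C1 * exp (- \<gamma> * snd p / \<epsilon>)"
    proof (rule layer_residual_le[OF cut(2) trace(2,4) K1 \<epsilon> \<gamma>,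
          where a = "\<lambda>p. b2 (prod.swap p)" and c = "\<lambda>p. b1 (prod.swap p)"])
      show "2 * \<gamma> \<le> b1 (0, s)" if "s \<in> {0<..<1}" for s using edge(1)[of s] that \<gamma> by auto
      show "\<bar>b2 (prod.swap p)\<bar> \<le> K" "\<bar>b1 (prod.swap p)\<bar> \<le> K" if "p \<in> Omega" for p
        using bK[of "prod.swap p"] that by (cases p; simp)+
      show "\<bar>b1 (0, fst p) - b1 (prod.swap p)\<bar> \<le> K * snd p" if "p \<in> Omega" for p
        using Lp(1)[of 0 "fst p" "snd p" "fst p"] that by (cases p) auto
    qed (use that in \<open>simp add: C1_def G_def\<close>)
    define Lx Ly Lxx Lyy where "Lx = (\<lambda>p. Lx' (prod.swap p))" and "Ly = (\<lambda>p. Ly' (prod.swap p))"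
      and "Lxx = (\<lambda>p. Lxx' (prod.swap p))" and "Lyy = (\<lambda>p. Lyy' (prod.swap p))"
    have TL: "C2_partials (theta_L \<sigma>L b1 u0 \<epsilon>) Lx Ly Lxx Lyy"
      using C2_partials_swap[OF TL'(1)] by (simp add: theta_L_eq Lx_def Ly_def Lxx_def Lyy_def)
    have TL2: "\<bar>- \<epsilon> * (Lxx p + Lyy p) - b1 p * Lx p - b2 p * Ly p\<bar> \<le> C1 * exp (- \<gamma> * fst p / \<epsilon>)"
      if "p \<in> Omega" for p
    proof -
      have "prod.swap p \<in> Omega" using that by (cases p) auto
      from TL'(2)[OF this] show ?thesis by (simp add: Lx_def Ly_def Lxx_def Lyy_def algebra_simps)
    qed
    obtain Ex Ey Exx Eyy where TE: "C2_partials (eta \<sigma>L \<sigma>B b1 b2 u0 \<epsilon>) Ex Ey Exx Eyy"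
      "\<And>p. p \<in> Omega \<Longrightarrow> \<bar>- \<epsilon> * (Exx p + Eyy p) - b1 p * Ex p - b2 p * Ey p\<bar> \<le> C2 * exp (- \<gamma> * snd p / \<epsilon>)"
    proof (rule corner_layer_residual_le[OF cut(2,1) K1 \<epsilon> \<gamma>, where a = b1 and c = b2 and m = "u0 (0, 0)"
          and \<alpha> = "b1 (0, 0)" and \<beta> = "b2 (0, 0)"])
      show "2 * \<gamma> \<le> b1 (0, 0)" "2 * \<gamma> \<le> b2 (0, 0)" using edge[of 0] \<gamma> by auto
      show "\<bar>b1 p\<bar> \<le> K" "\<bar>b2 p\<bar> \<le> K" if "p \<in> Omega" for p using bK[OF sub[OF that]] by auto
      show "\<bar>b1 (0, 0)\<bar> \<le> K" "\<bar>b2 (0, 0)\<bar> \<le> K" "\<bar>u0 (0, 0)\<bar> \<le> K" using bK by auto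
      show "\<bar>b1 (0, 0) - b1 p\<bar> \<le> K * (fst p + snd p)" "\<bar>b2 (0, 0) - b2 p\<bar> \<le> K * (fst p + snd p)"
        if "p \<in> Omega" for p
        using Lp[of 0 0 "fst p" "snd p"] that by (cases p; simp)+
    qed (use that in \<open>simp add: eta_eq C2_def G_def\<close>)
    define wx wy wxx wyy where "wx = (\<lambda>p. vx p - ux p - Bx p - Lx p - Ex p)"
      and "wy = (\<lambda>p. vy p - uy p - By p - Ly p - Ey p)"
      and "wxx = (\<lambda>p. vxx p - uxx p - Bxx p - Lxx p - Exx p)"
      and "wyy = (\<lambda>p. vyy p - uyy p - Byy p - Lyy p - Eyy p)"
    have C2w: "C2_partials w wx wy wxx wyy"
      unfolding w_eq wx_def wy_def wxx_def wyy_def by (intro C2_partials_diff C2u C2b TB TL TE)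
    have res: "\<bar>- \<epsilon> * (wxx p + wyy p) - b1 p * wx p - b2 p * wy p\<bar> \<le> C * \<rho> p" if p: "p \<in> Omega" for p
    proof -
      define RB where "RB = - \<epsilon> * (Bxx p + Byy p) - b1 p * Bx p - b2 p * By p"
      define RL where "RL = - \<epsilon> * (Lxx p + Lyy p) - b1 p * Lx p - b2 p * Ly p"
      define RE where "RE = - \<epsilon> * (Exx p + Eyy p) - b1 p * Ex p - b2 p * Ey p"
      have "- \<epsilon> * (vxx p + vyy p) - (b1 p * vx p + b2 p * vy p) = f p"
        using sol p C2_partials_deriv[OF C2u p] by (auto simp: perturbed_solution_def laplacian_def grad_def)
      moreover have "- b1 p * ux p - b2 p * uy p = f p"
        using lim p C2_partials_deriv[OF C2b(3) p] by (auto simp: limit_solution_def)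
      \<comment> \<open>The limit equation cancels f, leaving \<epsilon> \<Delta>u0 and the
        residuals of the correctors.\<close>
      ultimately have "- \<epsilon> * (wxx p + wyy p) - b1 p * wx p - b2 p * wy p = \<epsilon> * (uxx p + uyy p) - RB - RL - RE"
        by (simp add: wx_def wy_def wxx_def wyy_def RB_def RL_def RE_def algebra_simps)
      moreover have "\<bar>\<epsilon> * (uxx p + uyy p)\<bar> \<le> \<epsilon> * (2 * K)"
      proof (rule abs_mult_le)
        have "\<bar>uxx p\<bar> \<le> K" "\<bar>uyy p\<bar> \<le> K" using K[OF _ sub[OF p]] FI by blast+
        thus "\<bar>uxx p + uyy p\<bar> \<le> 2 * K" by linarith
      qed (use \<epsilon> in simp)
      moreover have "\<bar>RB\<bar> \<le> C1 * exp (- \<gamma> * snd p / \<epsilon>)" "\<bar>RL\<bar> \<le> C1 * exp (- \<gamma> * fst p / \<epsilon>)"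
        "\<bar>RE\<bar> \<le> C2 * exp (- \<gamma> * snd p / \<epsilon>)"
        unfolding RB_def RL_def RE_def using TB(2) TL2 TE(2) p by blast+
      moreover have "\<epsilon> * (2 * K) + C1 * X + (C1 + C2) * Y \<le> C * (\<epsilon> + X + Y)" if "X > 0" "Y > 0" for X Y
      proof -
        have "\<epsilon> * (2 * K) \<le> \<epsilon> * C" "C1 * X \<le> C * X" "(C1 + C2) * Y \<le> C * Y"
          using C0 K1 \<epsilon> that by (auto simp: C_def intro!: mult_left_mono mult_right_mono)
        thus ?thesis by (simp add: algebra_simps)
      qed
      note this[of "exp (- \<gamma> * fst p / \<epsilon>)" "exp (- \<gamma> * snd p / \<epsilon>)"]
      ultimately show ?thesis unfolding \<rho>_def distrib_right[of C1 C2] by simp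
    qed
    have c: "continuous_on ?S (\<lambda>p. \<sigma>B (snd p))" "continuous_on ?S (\<lambda>p. \<sigma>L (fst p))"
      "continuous_on ?S (\<lambda>p. u0 (fst p, 0))" "continuous_on ?S (\<lambda>p. u0 (0, snd p))"
      "continuous_on ?S (\<lambda>p. b2 (fst p, 0))" "continuous_on ?S (\<lambda>p. b1 (0, snd p))"
      by (rule continuous_on_compose2[OF cutoff_derivs(3)[OF \<sigma>B]] continuous_on_compose2[OF cutoff_derivs(3)[OF \<sigma>L]]
          continuous_on_compose2[OF u0'(4)] continuous_on_compose2[OF b1(4)] continuous_on_compose2[OF b2(4)];
          auto intro!: continuous_intros simp: closure_Omega)+
    have wc: "continuous_on ?S w"
      unfolding w_eq theta_B_eq theta_L_eq eta_eq using sol u0'(4) \<epsilon>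
      by (intro continuous_intros c) (auto simp: perturbed_solution_def)
    have w0: "w p = 0" if "p \<in> frontier Omega" for p
      unfolding w_eq using sol lim \<sigma>B \<sigma>L that
      by (intro remainder_boundary) (auto simp: perturbed_solution_def limit_solution_def)
    have wM: "\<bar>w p\<bar> \<le> M * \<epsilon>" if "p \<in> Omega" for p
    proof -
      have "\<bar>w p\<bar> \<le> \<epsilon> * M"
        unfolding M_def B_def
        by (rule barrier_estimate[OF C2w wc w0 \<epsilon>(1) \<gamma> r(1) \<mu>(2) C0(3), where ?b1.0 = b1 and ?b2.0 = b2])
          (use pos near near' \<mu>(5) sub that res in \<open>auto simp: \<rho>_def less_imp_le\<close>)
      thus ?thesis by (simp add: mult.commute)
    qed
    have \<rho>: "\<epsilon> \<le> \<rho> p" "exp (- \<gamma> * fst p / \<epsilon>) \<le> \<rho> p" "exp (- \<gamma> * snd p / \<epsilon>) \<le> \<rho> p" for p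
      using \<epsilon> by (simp_all add: \<rho>_def add_nonneg_nonneg)
    have wO: "continuous_on Omega w" using C2w by (simp add: C2_partials_def)
    have "(w p)\<^sup>2 \<le> M\<^sup>2 * \<epsilon> * \<rho> p" if "p \<in> Omega" for p
    proof -
      have "(w p)\<^sup>2 \<le> (M * \<epsilon>)\<^sup>2" using wM[OF that] by (simp add: abs_le_square_iff[symmetric] M0 \<epsilon>(1) less_imp_le)
      also have "\<dots> = M\<^sup>2 * \<epsilon> * \<epsilon>" by (simp add: power2_eq_square)
      also have "\<dots> \<le> M\<^sup>2 * \<epsilon> * \<rho> p" using \<epsilon> \<rho> by (intro mult_left_mono) auto
      finally show ?thesis .
    qed
    hence wL: "in_L2 w" "L2_norm w \<le> sqrt (M\<^sup>2 * \<epsilon> * (\<epsilon> * (1 + 2 / \<gamma>)))"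
      using in_L2_pointwise[OF wO \<epsilon>(1) \<gamma>, of "M\<^sup>2 * \<epsilon>"] \<epsilon> by (auto simp: \<rho>_def)
    have "M\<^sup>2 * \<epsilon> * (\<epsilon> * (1 + 2 / \<gamma>)) = (M * \<epsilon>)\<^sup>2 * (1 + 2 / \<gamma>)" by (simp add: power2_eq_square)
    hence "sqrt (M\<^sup>2 * \<epsilon> * (\<epsilon> * (1 + 2 / \<gamma>))) = M * \<epsilon> * sqrt (1 + 2 / \<gamma>)"
      using M0 \<epsilon> by (simp only: real_sqrt_mult) simp
    hence wL': "L2_norm w \<le> M * sqrt (1 + 2 / \<gamma>) * \<epsilon>"
      using wL(2) by (simp add: mult_ac)
    have gw: "grad w p = (wx p, wy p)" if "p \<in> Omega" for p
      using C2_partials_deriv[OF C2w that] by (simp add: grad_def)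
    have "continuous_on Omega (\<lambda>p. (wx p, wy p))"
      using C2w by (auto simp: C2_partials_def intro!: continuous_intros)
    hence gc: "continuous_on Omega (grad w)"
      by (subst continuous_on_cong[OF refl gw])
    have "integral (square a) (\<lambda>p. (norm (grad w p))\<^sup>2) \<le> \<epsilon> * Q" if a: "0 < a" "a < 1/2" for a
    proof -
      have "integral (square a) (\<lambda>p. (norm (grad w p))\<^sup>2) = integral (square a) (\<lambda>p. (wx p)\<^sup>2 + (wy p)\<^sup>2)"
      proof (rule integral_cong)
        fix p assume "p \<in> square a"
        hence "p \<in> Omega" using square_subset_Omega a by blast
        thus "(norm (grad w p))\<^sup>2 = (wx p)\<^sup>2 + (wy p)\<^sup>2" by (simp only: gw) (simp add: norm_Pair)
      qed
      also have "\<dots> \<le> \<epsilon> * Q"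
        unfolding Q_def
      proof (rule gradient_estimate[OF C2w wc w0, where ?b1.0 = b1 and ?b2.0 = b2 and b1x = b1x and b2y = b2y])
        show "\<bar>b1x p + b2y p\<bar> \<le> 2 * K" if "p \<in> Omega" for p
        proof -
          have "\<bar>b1x p\<bar> \<le> K" "\<bar>b2y p\<bar> \<le> K" using K[OF _ sub[OF that]] FI by blast+
          thus ?thesis by linarith
        qed
        show "\<bar>b1 p\<bar> \<le> K" "\<bar>b2 p\<bar> \<le> K" if "p \<in> Omega" for p using bK[OF sub[OF that]] by auto
      qed (use C2b \<epsilon> \<gamma> C0 a wM res in \<open>simp_all add: C2_partials_def \<rho>_def\<close>)
      finally show ?thesis .
    qed
    note gL = in_L2_exhaustion[OF gc this]
    have "sqrt \<epsilon> * L2_norm (grad w) \<le> sqrt \<epsilon> * sqrt (\<epsilon> * Q)"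
      using gL(2) \<epsilon> by (intro mult_left_mono) auto
    also have "\<dots> = sqrt Q * \<epsilon>" using \<epsilon> by (simp add: real_sqrt_mult)
    \<comment> \<open>The gradient norm is only of order sqrt \<epsilon>; the weight sqrt \<epsilon>
      in the norm supplies the other half power.\<close>
    finally have "eps_norm \<epsilon> w \<le> (M * sqrt (1 + 2 / \<gamma>) + sqrt Q) * \<epsilon>"
      using wL' by (simp add: eps_norm_def algebra_simps)
    also have "\<dots> \<le> \<kappa> * \<epsilon>"
      using \<epsilon> N0 \<gamma> by (intro mult_right_mono) (auto simp: \<kappa>_def)
    finally have en: "eps_norm \<epsilon> w \<le> \<kappa> * \<epsilon>" .
    have "\<bar>u p - u0 p\<bar> \<le> N * \<rho> p" if p: "p \<in> Omega" for p
    proof -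
      obtain x y where xy: "p = (x, y)" "0 < x" "x < 1" "0 < y" "y < 1" using p by (cases p) auto
      have 1: "\<bar>w p\<bar> \<le> M * \<rho> p"
        using wM[OF p] mult_left_mono[OF \<rho>(1) M0] by (meson order_trans)
      have 2: "\<bar>theta_B \<sigma>B b2 u0 \<epsilon> p\<bar> \<le> K\<^sup>2 * exp (- \<gamma> * snd p / \<epsilon>)"
        unfolding theta_B_eq using xy edge(2)[of x] \<sigma>b[of y] bK(3)[of "(x, 0)"] \<epsilon> \<gamma> by (intro layer_term_le) auto
      have 3: "\<bar>theta_L \<sigma>L b1 u0 \<epsilon> p\<bar> \<le> K\<^sup>2 * exp (- \<gamma> * fst p / \<epsilon>)"
        unfolding theta_L_eq using xy edge(1)[of y] \<sigma>b[of x] bK(3)[of "(0, y)"] \<epsilon> \<gamma> by (intro layer_term_le) auto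
      have "\<bar>\<sigma>L x * exp (- b1 (0, 0) * x / \<epsilon>)\<bar> \<le> K * 1"
        using xy edge(1)[of 0] \<sigma>b[of x] \<epsilon> \<gamma> by (intro abs_mult_le) (auto intro!: divide_nonneg_nonneg mult_nonneg_nonneg)
      moreover have "\<bar>- \<sigma>B y * u0 (0, 0) * exp (- b2 (0, 0) * y / \<epsilon>)\<bar> \<le> K\<^sup>2 * exp (- \<gamma> * y / \<epsilon>)"
        using xy edge(2)[of 0] \<sigma>b[of y] bK(3)[of "(0, 0)"] \<epsilon> \<gamma> by (intro layer_term_le) auto
      ultimately have "\<bar>(\<sigma>L x * exp (- b1 (0, 0) * x / \<epsilon>)) * (- \<sigma>B y * u0 (0, 0) * exp (- b2 (0, 0) * y / \<epsilon>))\<bar>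
          \<le> (K * 1) * (K\<^sup>2 * exp (- \<gamma> * y / \<epsilon>))"
        by (rule abs_mult_le)
      moreover have "(\<sigma>L x * exp (- b1 (0, 0) * x / \<epsilon>)) * (- \<sigma>B y * u0 (0, 0) * exp (- b2 (0, 0) * y / \<epsilon>))
          = - eta \<sigma>L \<sigma>B b1 b2 u0 \<epsilon> p"
        by (simp add: eta_def xy(1))
      ultimately have 4: "\<bar>eta \<sigma>L \<sigma>B b1 b2 u0 \<epsilon> p\<bar> \<le> K ^ 3 * exp (- \<gamma> * snd p / \<epsilon>)"
        by (simp add: xy(1) eval_nat_numeral mult.assoc)
      have "K\<^sup>2 * exp (- \<gamma> * snd p / \<epsilon>) \<le> K\<^sup>2 * \<rho> p" "K\<^sup>2 * exp (- \<gamma> * fst p / \<epsilon>) \<le> K\<^sup>2 * \<rho> p"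
        "K ^ 3 * exp (- \<gamma> * snd p / \<epsilon>) \<le> K ^ 3 * \<rho> p"
        using \<rho> K1 by (auto intro!: mult_left_mono)
      moreover have "N * \<rho> p = M * \<rho> p + K\<^sup>2 * \<rho> p + K\<^sup>2 * \<rho> p + K ^ 3 * \<rho> p"
        by (simp add: N_def algebra_simps)
      moreover have "u p - u0 p = w p + theta_B \<sigma>B b2 u0 \<epsilon> p + theta_L \<sigma>L b1 u0 \<epsilon> p + eta \<sigma>L \<sigma>B b1 b2 u0 \<epsilon> p"
        by (simp add: w_eq)
      ultimately show ?thesis using 1 2 3 4 by linarith
    qed
    note ud = this
    \<comment> \<open>As \<rho> \<le> 3, its square is at most 3 \<rho>, which brings the bound into
      the form required by \<open>in_L2_pointwise\<close>.\<close>
    have "(u p - u0 p)\<^sup>2 \<le> 3 * N\<^sup>2 * \<rho> p" if p: "p \<in> Omega" for p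
    proof -
      have \<rho>0: "0 \<le> \<rho> p" using \<rho>(1)[of p] \<epsilon> by linarith
      have "exp (- \<gamma> * fst p / \<epsilon>) \<le> 1" "exp (- \<gamma> * snd p / \<epsilon>) \<le> 1"
        using p \<gamma> \<epsilon> by (cases p; auto intro!: divide_nonneg_nonneg mult_nonneg_nonneg)+
      hence "\<rho> p \<le> 3" using \<epsilon> unfolding \<rho>_def by linarith
      hence "\<rho> p * \<rho> p \<le> 3 * \<rho> p" using \<rho>0 by (intro mult_right_mono)
      hence "N\<^sup>2 * (\<rho> p * \<rho> p) \<le> N\<^sup>2 * (3 * \<rho> p)" by (intro mult_left_mono) auto
      moreover have "(u p - u0 p)\<^sup>2 \<le> (N * \<rho> p)\<^sup>2"
        using ud[OF p] N0 \<rho>0 by (simp add: abs_le_square_iff[symmetric])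
      ultimately show ?thesis by (simp add: power2_eq_square mult_ac)
    qed
    moreover have "continuous_on Omega (\<lambda>p. u p - u0 p)"
      using C2u C2b(3) by (auto simp: C2_partials_def intro: continuous_on_diff)
    ultimately have uL: "in_L2 (\<lambda>p. u p - u0 p)" "L2_norm (\<lambda>p. u p - u0 p) \<le> sqrt (3 * N\<^sup>2 * (\<epsilon> * (1 + 2 / \<gamma>)))"
      using in_L2_pointwise[OF _ \<epsilon>(1) \<gamma>, of "\<lambda>p. u p - u0 p" "3 * N\<^sup>2"] by (auto simp: \<rho>_def)
    have "sqrt (3 * N\<^sup>2 * (\<epsilon> * (1 + 2 / \<gamma>))) = N * sqrt (3 * (1 + 2 / \<gamma>)) * sqrt \<epsilon>"
    proof -
      have "3 * N\<^sup>2 * (\<epsilon> * q) = N\<^sup>2 * (3 * q) * \<epsilon>" for q by simp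
      thus ?thesis using N0 by (simp only: real_sqrt_mult) simp
    qed
    also have "\<dots> \<le> \<kappa> * sqrt \<epsilon>"
      using \<epsilon> M0 Q0 \<gamma> by (intro mult_right_mono) (auto simp: \<kappa>_def)
    finally have "L2_norm (\<lambda>p. u p - u0 p) \<le> \<kappa> * sqrt \<epsilon>" using uL(2) by linarith
    with wL(1) gL(1) en uL(1) show "in_L2 w \<and> in_L2 (grad w) \<and> eps_norm \<epsilon> w \<le> \<kappa> * \<epsilon>
       \<and> in_L2 (\<lambda>p. u p - u0 p) \<and> L2_norm (\<lambda>p. u p - u0 p) \<le> \<kappa> * sqrt \<epsilon>" by blast
  qed
qed

theorem theorem2p1:
  fixes b1 b2 f u0 :: "real \<times> real \<Rightarrow> real"
    and \<sigma>B \<sigma>L :: "real \<Rightarrow> real"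
    and u :: "real \<Rightarrow> real \<times> real \<Rightarrow> real"
    and \<epsilon>1 :: real
  assumes "Ck_on 2 (closure Omega) b1" and "Ck_on 2 (closure Omega) b2"
    and "Ck_on 1 (closure Omega) f"
    and "\<forall>p\<in>Omega. b1 p > 0 \<and> b2 p > 0"
    and "noncharacteristic b1 b2"
    and "Ck_on 2 (closure Omega) u0" and "limit_solution b1 b2 f u0"
    and "cutoff \<sigma>B" and "cutoff \<sigma>L"
    and "\<epsilon>1 > 0"
    and "\<And>\<epsilon>. 0 < \<epsilon> \<Longrightarrow> \<epsilon> < \<epsilon>1 \<Longrightarrow> perturbed_solution b1 b2 f \<epsilon> (u \<epsilon>)"
  shows "(\<exists>\<epsilon>0>0. \<epsilon>0 \<le> \<epsilon>1 \<and> (\<exists>\<kappa>. \<forall>\<epsilon>. 0 < \<epsilon> \<and> \<epsilon> < \<epsilon>0 \<longrightarrow>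
            (let w = (\<lambda>p. u \<epsilon> p - u0 p - theta_B \<sigma>B b2 u0 \<epsilon> p - theta_L \<sigma>L b1 u0 \<epsilon> p
                          - eta \<sigma>L \<sigma>B b1 b2 u0 \<epsilon> p)
             in in_L2 w \<and> in_L2 (grad w) \<and> eps_norm \<epsilon> w \<le> \<kappa> * \<epsilon> powr (3/4))
          \<and> in_L2 (\<lambda>p. u \<epsilon> p - u0 p) \<and> L2_norm (\<lambda>p. u \<epsilon> p - u0 p) \<le> \<kappa> * \<epsilon> powr (1/4)))
       \<and> ((\<lambda>\<epsilon>. L2_norm (\<lambda>p. u \<epsilon> p - u0 p)) \<longlongrightarrow> 0) (at_right 0)"
proof (rule expansion_estimate[OF assms(1,2,4-9)])
  fix \<kappa> :: real
  assume \<kappa>: "\<kappa> \<ge> 0"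
    "\<And>\<epsilon> u w. 0 < \<epsilon> \<Longrightarrow> \<epsilon> \<le> 1 \<Longrightarrow> perturbed_solution b1 b2 f \<epsilon> u \<Longrightarrow>
       w = (\<lambda>p. u p - u0 p - theta_B \<sigma>B b2 u0 \<epsilon> p - theta_L \<sigma>L b1 u0 \<epsilon> p - eta \<sigma>L \<sigma>B b1 b2 u0 \<epsilon> p) \<Longrightarrow>
       in_L2 w \<and> in_L2 (grad w) \<and> eps_norm \<epsilon> w \<le> \<kappa> * \<epsilon>
       \<and> in_L2 (\<lambda>p. u p - u0 p) \<and> L2_norm (\<lambda>p. u p - u0 p) \<le> \<kappa> * sqrt \<epsilon>"
  \<comment> \<open>The cap at 1 makes \<epsilon> and sqrt \<epsilon> at most the powers 3/4 and 1/4
    of \<epsilon>.\<close>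
  define \<epsilon>0 where "\<epsilon>0 = min \<epsilon>1 1"
  have \<epsilon>0: "\<epsilon>0 > 0" "\<epsilon>0 \<le> \<epsilon>1" using assms(10) by (auto simp: \<epsilon>0_def)
  have main: "(let w = (\<lambda>p. u \<epsilon> p - u0 p - theta_B \<sigma>B b2 u0 \<epsilon> p - theta_L \<sigma>L b1 u0 \<epsilon> p
                          - eta \<sigma>L \<sigma>B b1 b2 u0 \<epsilon> p)
             in in_L2 w \<and> in_L2 (grad w) \<and> eps_norm \<epsilon> w \<le> \<kappa> * \<epsilon> powr (3/4))
          \<and> in_L2 (\<lambda>p. u \<epsilon> p - u0 p) \<and> L2_norm (\<lambda>p. u \<epsilon> p - u0 p) \<le> \<kappa> * \<epsilon> powr (1/4)"
    if \<epsilon>: "0 < \<epsilon>" "\<epsilon> < \<epsilon>0" for \<epsilon>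
  proof -
    have \<epsilon>': "\<epsilon> \<le> 1" "\<epsilon> < \<epsilon>1" using \<epsilon> by (auto simp: \<epsilon>0_def)
    have "\<epsilon> powr 1 \<le> \<epsilon> powr (3/4)" "\<epsilon> powr (1/2) \<le> \<epsilon> powr (1/4)"
      using \<epsilon> \<epsilon>' by (intro powr_mono'; simp)+
    hence "\<kappa> * \<epsilon> \<le> \<kappa> * \<epsilon> powr (3/4)" "\<kappa> * sqrt \<epsilon> \<le> \<kappa> * \<epsilon> powr (1/4)"
      using \<epsilon> \<kappa>(1) by (auto simp: powr_half_sqrt intro!: mult_left_mono)
    thus ?thesis
      using \<kappa>(2)[OF \<epsilon>(1) \<epsilon>'(1) assms(11)[OF \<epsilon>(1) \<epsilon>'(2)] refl] unfolding Let_def by (meson order_trans)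
  qed
  have lim0: "((\<lambda>\<epsilon>. L2_norm (\<lambda>p. u \<epsilon> p - u0 p)) \<longlongrightarrow> 0) (at_right 0)"
  proof (rule tendsto_sandwich)
    show "\<forall>\<^sub>F \<epsilon> in at_right 0. 0 \<le> L2_norm (\<lambda>p. u \<epsilon> p - u0 p)"
      by (simp add: L2_norm_def set_lebesgue_integral_def)
    show "\<forall>\<^sub>F \<epsilon> in at_right 0. L2_norm (\<lambda>p. u \<epsilon> p - u0 p) \<le> \<kappa> * \<epsilon> powr (1/4)"
      unfolding eventually_at_right_field using main \<epsilon>0(1) by blast
    have "((\<lambda>\<epsilon>::real. \<kappa> * \<epsilon> powr (1/4)) \<longlongrightarrow> \<kappa> * 0 powr (1/4)) (at_right 0)"
      by (intro tendsto_intros) (auto simp: eventually_at_filter)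
    thus "((\<lambda>\<epsilon>::real. \<kappa> * \<epsilon> powr (1/4)) \<longlongrightarrow> 0) (at_right 0)" by simp
  qed simp
  show ?thesis using \<epsilon>0 main lim0 by blast
qed

end
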